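(* Let $p$ be a prime number and let $r$ and $n$ be positive integers such that $p^{n-1}<r\le \frac{p-1}{2}\,p^{n-1}$. Let $s=b\,p^{n-1}+d$ with $b,d$ integers. Then $$c(r,s,p)=\mathrm{rev}\left(c\left(r,\,b\,p^{n-1}+(p^{n-1}-d),\,p\right)\right)$$ whenever both $s=b\,p^{n-1}+d$ and $b\,p^{n-1}+p^{n-1}-d$ are at least $r$ and at most $\left(p-\lceil r/p^{n-1}\rceil\right)p^{n-1}$.
   Context: Let $p$ be a prime and $F$ a field of characteristic $p$. For a positive integer $m$, $J_m$ denotes the full $m\times m$ Jordan block matrix over $F$ with eigenvalue $1$. For positive integers $r\le s$, the Jordan canonical form of the $rs\times rs$ matrix $J_r\otimes J_s$ (Kronecker product) is $J_{\lambda_1}\oplus J_{\lambda_2}\oplus\cdots\oplus J_{\lambda_r}$ with exactly $r$ blocks, where $\lambda_1\ge\lambda_2\ge\cdots\ge\lambda_r>0$. The resulting partition $\lambda(r,s,p)=(\lambda_1,\dots,\lambda_r)$ of $rs$ is called the Jordan partition; it depends only on $r$, $s$ and $p$. Write $$\lambda(r,s,p)=(\overbrace{\mu_1,\dots,\mu_1}^{m_1},\overbrace{\mu_2,\dots,\mu_2}^{m_2},\dots,\overbrace{\mu_k,\dots,\mu_k}^{m_k}),\qquad \mu_1>\mu_2>\cdots>\mu_k>0,$$ with each $m_i\ge 1$. Then $c(r,s,p)$ denotes the composition $(m_1,\dots,m_k)$ of $r$, i.e. the finite sequence of multiplicities of the distinct Jordan block sizes, listed in order of decreasing block size. Two compositions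 are equal if they are equal as finite sequences. For a finite sequence, $\mathrm{rev}((m_1,\dots,m_k))=(m_k,\dots,m_1)$. $\lceil x\rceil$ denotes the least integer $\ge x$. *)

theory Defs
  imports
    Jordan_Normal_Form.Jordan_Normal_Form_Existence
    Jordan_Normal_Form.Jordan_Normal_Form_Uniqueness
    "HOL-Computational_Algebra.Primes"
begin

definition kronecker_product :: "'a::semiring_0 mat \<Rightarrow> 'a mat \<Rightarrow> 'a mat" where
  "kronecker_product A B =
     mat (dim_row A * dim_row B) (dim_col A * dim_col B)
       (\<lambda>(i, j). A $$ (i div dim_row B, j div dim_col B) * B $$ (i mod dim_row B, j mod dim_col B))"

definition is_jordan_partition :: "'a::field itself \<Rightarrow> nat \<Rightarrow> nat \<Rightarrow> nat list \<Rightarrow> bool" where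
  "is_jordan_partition F r s ms \<longleftrightarrow>
     sorted_wrt (\<ge>) ms \<and>
     jordan_nf (kronecker_product (jordan_block r (1::'a)) (jordan_block s 1))
       (map (\<lambda>m. (m, 1)) ms)"

text \<open>The description below is meaningful for every field and all \<open>r\<close>, \<open>s\<close>; see
  \<open>is_jordan_partition_ex1\<close> at the end of this theory.  Positivity of the parts is built
  into \<^const>\<open>jordan_nf\<close>.\<close>

definition jordan_partition :: "'a::field itself \<Rightarrow> nat \<Rightarrow> nat \<Rightarrow> nat list" where
  "jordan_partition F r s = (THE ms. is_jordan_partition F r s ms)"

definition jordan_composition :: "'a::field itself \<Rightarrow> nat \<Rightarrow> nat \<Rightarrow> nat list" where
  "jordan_composition F r s =
     (let ms = jordan_partition F r s
      in map (count_list ms) (rev (sorted_list_of_set (set ms))))"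

lemma jordan_matrix_append:
  "jordan_matrix (xs @ ys) = four_block_mat (jordan_matrix xs)
     (0\<^sub>m (sum_list (map fst xs)) (sum_list (map fst ys)))
     (0\<^sub>m (sum_list (map fst ys)) (sum_list (map fst xs))) (jordan_matrix ys)"
  using jordan_matrix_dim[of xs] jordan_matrix_dim[of ys]
  unfolding jordan_matrix_def map_append diag_block_mat_append Let_def by metis

lemma similar_mat_block_swap:
  fixes A B :: "'a::field mat"
  assumes A: "A \<in> carrier_mat n n" and B: "B \<in> carrier_mat m m"
  shows "similar_mat (four_block_mat A (0\<^sub>m n m) (0\<^sub>m m n) B)
                     (four_block_mat B (0\<^sub>m m n) (0\<^sub>m n m) A)"
proof -
  let ?P = "four_block_mat (0\<^sub>m n m) (1\<^sub>m n) (1\<^sub>m m) (0\<^sub>m m n) :: 'a mat"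
  let ?Q = "four_block_mat (0\<^sub>m m n) (1\<^sub>m m) (1\<^sub>m n) (0\<^sub>m n m) :: 'a mat"
  let ?A = "four_block_mat A (0\<^sub>m n m) (0\<^sub>m m n) B"
  let ?B = "four_block_mat B (0\<^sub>m m n) (0\<^sub>m n m) A"
  have c: "?P \<in> carrier_mat (n + m) (m + n)" "?Q \<in> carrier_mat (m + n) (n + m)" by auto
  have PQ: "?P * ?Q = 1\<^sub>m (n + m)"
    by (subst mult_four_block_mat[of _ n m _ n _ m _ _ n _ m]) (auto simp: four_block_one_mat)
  have QP: "?Q * ?P = 1\<^sub>m (m + n)"
    by (subst mult_four_block_mat[of _ m n _ m _ n _ _ m _ n]) (auto simp: four_block_one_mat)
  have PB: "?P * ?B = four_block_mat (0\<^sub>m n m) A B (0\<^sub>m m n)"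
    using A B by (subst mult_four_block_mat[of _ n m _ n _ m _ _ m _ n]) auto
  have "?P * ?B * ?Q = ?A"
    unfolding PB using A B
    by (subst mult_four_block_mat[of _ n m _ n _ m _ _ n _ m]) auto
  then show ?thesis
    using PQ QP c A B by (intro similar_matI[of _ _ ?P ?Q "n + m"]) (auto simp: add.commute)
qed

lemma similar_mat_jordan_matrix_mset:
  fixes xs ys :: "(nat \<times> 'a::field) list"
  assumes "mset xs = mset ys"
  shows "similar_mat (jordan_matrix xs) (jordan_matrix ys)"
  using assms
proof (induction xs arbitrary: ys)
  case Nil
  then show ?case by (auto intro: similar_mat_refl jordan_matrix_carrier)
next
  case (Cons x xs)
  then have "x \<in> set ys" by (metis list.set_intros(1) set_mset_mset)
  then obtain us vs where ys: "ys = us @ x # vs" by (meson split_list)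
  with Cons.prems have "mset xs = mset (us @ vs)" by simp
  then have IH: "similar_mat (jordan_matrix xs) (jordan_matrix (us @ vs))" by (rule Cons.IH)
  have app: "similar_mat (jordan_matrix (as @ bs)) (jordan_matrix (as' @ bs'))"
    if "similar_mat (jordan_matrix as) (jordan_matrix as')"
       "similar_mat (jordan_matrix bs) (jordan_matrix bs')"
       "sum_list (map fst as) = sum_list (map fst as')"
       "sum_list (map fst bs) = sum_list (map fst bs')"
    for as as' bs bs' :: "(nat \<times> 'a) list"
    unfolding jordan_matrix_append using that
    by (metis similar_mat_four_block_0_0 jordan_matrix_carrier)
  have refl: "similar_mat (jordan_matrix as) (jordan_matrix as)" for as :: "(nat \<times> 'a) list"
    by (rule similar_mat_refl[OF jordan_matrix_carrier])
  have sum: "sum_list (map fst xs) = sum_list (map fst (us @ vs))"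
    using \<open>mset xs = mset (us @ vs)\<close> by (metis mset_map sum_mset_sum_list)
  have "similar_mat (jordan_matrix ([x] @ xs)) (jordan_matrix ([x] @ (us @ vs)))"
    by (rule app[OF refl IH _ sum]) simp
  moreover have "similar_mat (jordan_matrix ([x] @ us)) (jordan_matrix (us @ [x]))"
    unfolding jordan_matrix_append
    by (rule similar_mat_block_swap[OF jordan_matrix_carrier jordan_matrix_carrier])
  then have "similar_mat (jordan_matrix (([x] @ us) @ vs)) (jordan_matrix ((us @ [x]) @ vs))"
    by (rule app) (auto intro: refl)
  ultimately show ?case
    unfolding ys by (auto intro: similar_mat_trans)
qed

lemma kronecker_jordan_block_upper_triangular:
  "upper_triangular (kronecker_product (jordan_block r (1::'a::field)) (jordan_block s 1))"
proof (rule upper_triangularI)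
  fix i j
  assume ji: "j < i"
    and "i < dim_row (kronecker_product (jordan_block r (1::'a)) (jordan_block s 1))"
  then have i: "i < r * s" by (simp add: kronecker_product_def)
  then have s: "s > 0" by (cases s) auto
  have d: "i div s < r" "j div s < r" "j div s \<le> i div s"
    using i ji by (auto simp: less_mult_imp_div_less div_le_mono)
  have m: "j mod s < i mod s" if "i div s = j div s"
    using ji that by (metis add_less_cancel_left div_mult_mod_eq)
  show "kronecker_product (jordan_block r (1::'a)) (jordan_block s 1) $$ (i, j) = 0"
    using i ji s d m by (auto simp: kronecker_product_def)
qed

lemma is_jordan_partition_ex1: "\<exists>!ms. is_jordan_partition TYPE('a::field) r s ms"
proof (rule ex_ex1I)
  let ?K = "kronecker_product (jordan_block r (1::'a)) (jordan_block s 1)"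
  have K: "?K \<in> carrier_mat (r * s) (r * s)" by (simp add: kronecker_product_def)
  obtain xs where xs: "jordan_nf ?K xs"
    using triangular_to_jnf_vector[OF K kronecker_jordan_block_upper_triangular] by blast
  have "char_poly ?K = (\<Prod>a\<leftarrow>diag_mat ?K. [:- a, 1:])"
    by (rule char_poly_upper_triangular[OF K kronecker_jordan_block_upper_triangular])
  moreover have "a = 1" if a: "a \<in> set (diag_mat ?K)" for a
  proof -
    from a obtain i where i: "i < r * s" "a = ?K $$ (i, i)"
      using K by (auto simp: diag_mat_def)
    moreover from i have "s > 0" "i div s < r"
      by (cases s, auto simp: less_mult_imp_div_less)
    ultimately show ?thesis by (simp add: kronecker_product_def)
  qed
  ultimately have root: "a = 1" if "poly (char_poly ?K) a = 0" for a
    using that by (auto simp: poly_prod_list prod_list_zero_iff)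
  have one: "a = 1" if na: "(n, a) \<in> set xs" for n a
  proof (rule root)
    from xs na have "n \<noteq> 0" by (force simp: jordan_nf_def)
    with na show "poly (char_poly ?K) a = 0"
      unfolding jordan_nf_char_poly[OF xs]
      by (auto simp: poly_prod_list prod_list_zero_iff intro!: image_eqI[of _ _ "(n, a)"])
  qed
  let ?l = "rev (sort (map fst xs))"
  have "map (\<lambda>m. (m, 1)) (map fst xs) = xs"
    using one by (auto intro!: map_idI)
  then have mxs: "mset xs = mset (map (\<lambda>m. (m, 1)) ?l)"
    by (metis mset_map mset_rev mset_sort)
  then have "similar_mat (jordan_matrix xs) (jordan_matrix (map (\<lambda>m. (m, 1)) ?l))"
    by (rule similar_mat_jordan_matrix_mset)
  moreover have "set xs = set (map (\<lambda>m. (m, 1)) ?l)"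
    using mxs by (rule mset_eq_setD)
  ultimately have "jordan_nf ?K (map (\<lambda>m. (m, 1)) ?l)"
    using xs similar_mat_trans unfolding jordan_nf_def by metis
  moreover have "sorted_wrt (\<ge>) ?l" by (simp add: sorted_wrt_rev)
  ultimately show "\<exists>ms. is_jordan_partition TYPE('a) r s ms"
    unfolding is_jordan_partition_def by blast
next
  fix xs ys
  assume *: "is_jordan_partition TYPE('a) r s xs" "is_jordan_partition TYPE('a) r s ys"
  let ?K = "kronecker_product (jordan_block r (1::'a)) (jordan_block s 1)"
  have count: "count (mset zs) k =
      (if k = 0 then 0 else compute_nr_of_jordan_blocks ?K 1 k)"
    if "is_jordan_partition TYPE('a) r s zs" for zs k
  proof (cases "k = 0")
    case True
    with that show ?thesis
      by (force simp: is_jordan_partition_def jordan_nf_def count_eq_zero_iff)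
  next
    case False
    have "length (filter ((=) (k, 1::'a)) (map (\<lambda>m. (m, 1)) zs)) = count (mset zs) k"
      by (induction zs) auto
    with False compute_nr_of_jordan_blocks[of ?K "map (\<lambda>m. (m, 1)) zs" k 1] that
    show ?thesis by (simp add: is_jordan_partition_def)
  qed
  have "mset xs = mset ys"
    by (rule multiset_eqI) (simp add: count[OF *(1)] count[OF *(2)])
  moreover have "sorted (rev xs)" "sorted (rev ys)"
    using * by (auto simp: is_jordan_partition_def sorted_wrt_rev)
  ultimately show "xs = ys"
    by (metis mset_rev properties_for_sort rev_rev_ident)
qed

end

theory Submission
  imports Defs
begin

text \<open>
Let \<open>A = F[x, y] / (x^r, y^s)\<close> with \<open>r \<le> s\<close>, graded by total degree. The matrix
\<open>J_r \<otimes> J_s\<close> is multiplication by \<open>(1 + x)(1 + y)\<close> on \<open>A\<close>, so its nilpotent part is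
multiplication by \<open>x + (1 + x) y\<close>; as \<open>1 + x\<close> is a unit, the substitution of \<open>(1 + x) y\<close> for \<open>y\<close>
turns this into multiplication by the linear form \<open>l = x + y\<close>.

The quotient \<open>A / l A\<close> is \<open>F[x] / (x^r)\<close>. Hence \<open>A\<close> is generated as an \<open>F[l]\<close>-module by any choice
of forms \<open>g_a\<close>, \<open>a < r\<close>, with \<open>g_a\<close> of degree \<open>a\<close> outside \<open>l A\<close>. Choose \<open>g_a\<close> so that it is
annihilated as early as possible, and let \<open>M a\<close> be the least degree in which a multiple
\<open>l^(M a - a) g_a\<close> vanishes (\<open>annihilation_degree\<close>). Three observations determine the shape of \<open>M\<close>:
multiplication by \<open>x\<close> commutes with \<open>l\<close>, so \<open>M (a + 1) \<le> M a + 1\<close>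
(\<open>annihilation_degree_Suc\<close>); the kernel of \<open>l\<close> is at most one-dimensional in every degree, so \<open>M\<close>
is injective (\<open>annihilation_degree_inj\<close>); and \<open>s \<le> M a < r + s\<close>. Thus \<open>M\<close> is a bijection onto
\<open>{s..<r + s}\<close>, the lengths \<open>M a - a\<close> add up to \<open>r s\<close>, and the chains \<open>g_a, l g_a, l^2 g_a, ...\<close>
form a Jordan basis: the Jordan partition is the weakly decreasing sequence of the lengths
\<open>M a - a\<close> (\<open>jordan_partition_eq\<close>).

An injective sequence that never rises by more than one is layered: it splits into runs of
consecutive increasing integers, and every value of a run lies below all values of the previous
runs. The lengths are constant on a run, so the composition consists of the run lengths. A run ends
before position \<open>k\<close> exactly if the first \<open>k\<close> values are the \<open>k\<close> largest ones (\<open>drop_iff_prefix\<close>).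
This says that \<open>l^(r + s - 2 k)\<close> is injective on the forms of degree \<open>k - 1\<close>, that is, that a
certain \<open>k \<times> k\<close> determinant of binomial coefficients is nonzero in \<open>F\<close>
(\<open>prefix_iff_box_det\<close>). By MacMahon's formula (\<open>box_det_product\<close>) this determinant is
  \<^item> \<open>(\<Prod>i<k. \<Prod>j<r - k. s - k + i + j + 1) / (\<Prod>i<k. \<Prod>j<r - k. i + j + 1)\<close>.

Replace \<open>s\<close> by \<open>s'\<close> and \<open>k\<close> by \<open>r - k\<close>. The denominator does not change, and
each factor \<open>z\<close> of the numerator turns into \<open>s + s' - z\<close>. If \<open>p^m\<close> divides \<open>s + s'\<close>, and all factors
are smaller than \<open>p^(m + 1)\<close>, then \<open>z\<close> and \<open>s + s' - z\<close> contain the same power of \<open>p\<close>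
(\<open>dvd_box_det_symmetric\<close>). So the runs for \<open>s\<close> end before \<open>k\<close> if and only if the runs for \<open>s'\<close> end
before \<open>r - k\<close>, which is the asserted reversal. In the theorem \<open>m = n - 1\<close>, the sum
\<open>s + s'\<close> is \<open>(2 b + 1) p^(n - 1)\<close>, and the upper bounds imply \<open>r + s, r + s' \<le> p^n\<close>.
\<close>

section \<open>Binary forms annihilated modulo two pure powers\<close>

text \<open>
A form of degree \<open>m\<close> in \<open>x\<close> and \<open>l = x + y\<close> is encoded by the univariate polynomial \<open>c\<close> obtained by
setting \<open>l = 1\<close>: it is the sum of \<open>coeff c i * x^i * l^(m - i)\<close>. With this encoding multiplication by
\<open>l\<close> leaves \<open>c\<close> unchanged, multiplication by \<open>x\<close> is \<open>pCons 0\<close>, and a nonzero form is divisible by exactly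
\<open>l^(m - degree c)\<close>. The value below is the coefficient of \<open>x^(m - u) * y^u\<close> in that form.
\<close>

definition form_coeff :: "nat \<Rightarrow> 'a::field poly \<Rightarrow> nat \<Rightarrow> 'a" where
  "form_coeff m c u = (\<Sum>i\<le>m. coeff c i * of_nat ((m - i) choose u))"

text \<open>
The form of degree \<open>m\<close> encoded by \<open>c\<close> lies in the ideal generated by \<open>x^r\<close> and \<open>y^s\<close>.
\<close>

definition annihilated :: "nat \<Rightarrow> nat \<Rightarrow> nat \<Rightarrow> 'a::field poly \<Rightarrow> bool" where
  "annihilated r s m c \<longleftrightarrow> (\<forall>u<s. m < r + u \<longrightarrow> form_coeff m c u = 0)"

lemma form_coeff_eq_0: "m < u \<Longrightarrow> form_coeff m c u = 0"
  unfolding form_coeff_def by (intro sum.neutral) (auto simp: binomial_eq_0)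

lemma form_coeff_zero: "form_coeff m 0 u = 0"
  by (simp add: form_coeff_def)

lemma form_coeff_add: "form_coeff m (c + d) u = form_coeff m c u + form_coeff m d u"
  by (simp add: form_coeff_def algebra_simps sum.distrib)

lemma form_coeff_smult: "form_coeff m (Polynomial.smult k c) u = k * form_coeff m c u"
  by (simp add: form_coeff_def sum_distrib_left mult_ac)

lemma form_coeff_diff: "form_coeff m (c - d) u = form_coeff m c u - form_coeff m d u"
  by (simp add: form_coeff_def algebra_simps sum_subtractf)

lemma form_coeff_sum: "form_coeff m (sum f S) u = (\<Sum>x\<in>S. form_coeff m (f x) u)"
  by (induction S rule: infinite_finite_induct) (auto simp: form_coeff_zero form_coeff_add)

text \<open>
Pascal's rule: this is multiplication by \<open>l = x + y\<close>.
\<close>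

lemma form_coeff_Suc:
  assumes "degree c \<le> m"
  shows "form_coeff (Suc m) c u = form_coeff m c u + (if u = 0 then 0 else form_coeff m c (u - 1))"
proof -
  have "coeff c (Suc m) = 0" using assms by (simp add: coeff_eq_0)
  then have "form_coeff (Suc m) c u = (\<Sum>i\<le>m. coeff c i * of_nat (Suc (m - i) choose u))"
    unfolding form_coeff_def by (simp add: Suc_diff_le)
  also have "\<dots> = form_coeff m c u + (if u = 0 then 0 else form_coeff m c (u - 1))"
    by (cases u) (simp_all add: form_coeff_def algebra_simps sum.distrib)
  finally show ?thesis .
qed

lemma form_coeff_pCons_0: "form_coeff (Suc m) (pCons 0 c) u = form_coeff m c u"
  unfolding form_coeff_def by (subst sum.atMost_Suc_shift) simp

lemma annihilated_Suc:
  assumes "degree c \<le> m" "annihilated r s m c"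
  shows "annihilated r s (Suc m) c"
  unfolding annihilated_def
proof (intro allI impI)
  fix u assume u: "u < s" "Suc m < r + u"
  then have "form_coeff m c u = 0" "u > 0 \<Longrightarrow> form_coeff m c (u - 1) = 0"
    using assms(2) unfolding annihilated_def by auto
  then show "form_coeff (Suc m) c u = 0" by (simp add: form_coeff_Suc[OF assms(1)])
qed

lemma annihilated_mono:
  assumes "annihilated r s m c" "degree c \<le> m" "m \<le> m'"
  shows "annihilated r s m' c"
  using assms(3,1,2) by (induction m' rule: dec_induct) (auto intro: annihilated_Suc)

lemma annihilated_pCons_0:
  "annihilated r s m c \<Longrightarrow> annihilated r s (Suc m) (pCons 0 c)"
  unfolding annihilated_def by (auto simp: form_coeff_pCons_0)

text \<open>
If \<open>l * g\<close> vanishes modulo \<open>x^r\<close> and \<open>y^s\<close>, the coefficients of \<open>g\<close> outside the ideal alternate in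
sign, so all of them are determined by the one at \<open>y^(s - 1)\<close>. Hence the kernel of \<open>l\<close> is at
most one-dimensional in each degree.
\<close>

lemma annihilated_pred:
  assumes "degree c \<le> m" "annihilated r s (Suc m) c" "form_coeff m c (s - 1) = 0"
  shows "annihilated r s m c"
proof -
  have "form_coeff m c u = 0" if "u \<le> s - 1" "m < r + u" for u
    using that
  proof (induction u rule: inc_induct)
    case base
    then show ?case using assms(3) by simp
  next
    case (step u)
    have "form_coeff (Suc m) c (Suc u) = 0"
      using step assms(2) unfolding annihilated_def by auto
    moreover have "form_coeff m c (Suc u) = 0" using step by simp
    ultimately show ?case by (simp add: form_coeff_Suc[OF assms(1)])
  qed
  then show ?thesis unfolding annihilated_def by auto
qed

text \<open>
In degrees below \<open>s\<close> only \<open>x^r\<close> matters, and the lowest power of \<open>x\<close> in a form whose encoding has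
degree less than \<open>r\<close> survives.
\<close>

lemma annihilated_imp_ge:
  assumes "annihilated r s m c" "c \<noteq> 0" "degree c \<le> m" "degree c < r"
  shows "s \<le> m"
proof (rule ccontr)
  assume "\<not> s \<le> m"
  define i where "i = (LEAST i. coeff c i \<noteq> 0)"
  have ci: "coeff c i \<noteq> 0"
    unfolding i_def by (rule LeastI[of _ "degree c"]) (use assms(2) in simp)
  have below: "coeff c j = 0" if "j < i" for j
    using not_less_Least[of j "\<lambda>i. coeff c i \<noteq> 0"] that unfolding i_def by blast
  have i: "i \<le> degree c" by (rule le_degree[OF ci])
  \<comment> \<open>The coefficient of \<open>x^i y^(m - i)\<close> comes from the lowest term of \<open>c\<close> alone.\<close>
  have "form_coeff m c (m - i) = (\<Sum>j\<in>{i}. coeff c j * of_nat ((m - j) choose (m - i)))"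
    unfolding form_coeff_def
  proof (rule sum.mono_neutral_right)
    show "\<forall>j\<in>{..m} - {i}. coeff c j * of_nat ((m - j) choose (m - i)) = 0"
    proof
      fix j assume "j \<in> {..m} - {i}"
      then consider "j < i" | "j \<le> m" "m - j < m - i" using i assms(3) by fastforce
      then show "coeff c j * of_nat ((m - j) choose (m - i)) = 0"
        by cases (auto simp: below binomial_eq_0)
    qed
  qed (use i assms in auto)
  also have "\<dots> \<noteq> 0" using ci by simp
  finally show False using assms \<open>\<not> s \<le> m\<close> i unfolding annihilated_def by auto
qed

text \<open>
A form of degree \<open>a\<close> is not divisible by \<open>l\<close> exactly if its encoding has degree equal to \<open>a\<close>. Among
these forms the one annihilated earliest counts, and the degree where this happens is recorded
rather than the exponent of \<open>l\<close>.
\<close>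

definition annihilation_degree :: "'a::field itself \<Rightarrow> nat \<Rightarrow> nat \<Rightarrow> nat \<Rightarrow> nat" where
  "annihilation_degree F r s a =
     (LEAST m. a \<le> m \<and> (\<exists>c :: 'a poly. c \<noteq> 0 \<and> degree c = a \<and> annihilated r s m c))"

lemma annihilation_degree_le:
  assumes "annihilated r s m (c :: 'a::field poly)" "c \<noteq> 0" "degree c \<le> m"
  shows "annihilation_degree (F :: 'a itself) r s (degree c) \<le> m"
  unfolding annihilation_degree_def by (rule Least_le) (use assms in blast)

context
  fixes r s :: nat and F :: "'a::field itself"
  assumes rs: "r \<le> s"
begin

lemma annihilation_degree_witness:
  assumes "a < r"
  obtains c :: "'a poly" where "c \<noteq> 0" "degree c = a" "a \<le> annihilation_degree F r s a"
    "annihilated r s (annihilation_degree F r s a) c"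
proof -
  let ?P = "\<lambda>m. a \<le> m \<and> (\<exists>c :: 'a poly. c \<noteq> 0 \<and> degree c = a \<and> annihilated r s m c)"
  have "?P (r + s - 1)"
    using assms by (auto simp: annihilated_def degree_monom_eq intro!: exI[of _ "monom 1 a"])
  then have "?P (annihilation_degree F r s a)" unfolding annihilation_degree_def by (rule LeastI)
  then show ?thesis using that by blast
qed

lemma annihilation_degree_less: "a < r \<Longrightarrow> annihilation_degree F r s a < r + s"
proof -
  assume "a < r"
  have "annihilation_degree F r s a \<le> r + s - 1"
    unfolding annihilation_degree_def
    by (rule Least_le) (use \<open>a < r\<close> in
       \<open>auto simp: annihilated_def degree_monom_eq intro!: exI[of _ "monom 1 a"]\<close>)
  then show ?thesis using \<open>a < r\<close> by simp
qed

lemma annihilation_degree_ge: "a < r \<Longrightarrow> s \<le> annihilation_degree F r s a"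
  by (metis annihilation_degree_witness annihilated_imp_ge)

text \<open>
Multiplication by \<open>x\<close> commutes with \<open>l\<close> and raises the degree of the encoding by one.
\<close>

lemma annihilation_degree_Suc:
  "Suc a < r \<Longrightarrow> annihilation_degree F r s (Suc a) \<le> Suc (annihilation_degree F r s a)"
proof -
  assume a: "Suc a < r"
  then obtain c :: "'a poly" where c: "c \<noteq> 0" "degree c = a" "a \<le> annihilation_degree F r s a"
    "annihilated r s (annihilation_degree F r s a) c"
    using annihilation_degree_witness[of a] by auto
  then have "annihilated r s (Suc (annihilation_degree F r s a)) (pCons 0 c)" by (intro annihilated_pCons_0)
  from annihilation_degree_le[OF this] c show ?thesis
    by (simp add: degree_pCons_eq)
qed

lemma not_annihilated_below:
  assumes "degree c < r" "(c :: 'a poly) \<noteq> 0" "degree c \<le> m" "m < annihilation_degree F r s (degree c)"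
  shows "\<not> annihilated r s m c"
  using annihilation_degree_le[of r s m c F] assms by auto

text \<open>
If two generators were annihilated in the same degree \<open>Suc m\<close>, their multiples in degree \<open>m\<close> would
lie in the at most one-dimensional kernel of \<open>l\<close>. Subtracting a multiple of the one of lower degree
would then annihilate the other generator already in degree \<open>m\<close>.
\<close>

lemma annihilation_degree_inj: "inj_on (annihilation_degree F r s) {..<r}"
proof -
  have "annihilation_degree F r s a \<noteq> annihilation_degree F r s b" if ab: "a < b" "b < r" for a b
  proof
    assume eq: "annihilation_degree F r s a = annihilation_degree F r s b"
    obtain c :: "'a poly" where c: "c \<noteq> 0" "degree c = a"
    "annihilated r s (annihilation_degree F r s a) c"
      using annihilation_degree_witness[of a] ab by auto
    obtain d :: "'a poly" where d: "d \<noteq> 0" "degree d = b" "annihilated r s (annihilation_degree F r s b) d"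
      using annihilation_degree_witness[of b] ab by auto
    obtain m where m: "annihilation_degree F r s b = Suc m" using annihilation_degree_ge[of b] ab rs by (cases "annihilation_degree F r s b") auto
    have bm: "b \<le> m" using annihilation_degree_ge[of b] ab rs m by auto
    have nc: "form_coeff m c (s - 1) \<noteq> 0"
      using annihilated_pred[of c m r s] not_annihilated_below[of c m] c eq m bm ab by auto
    \<comment> \<open>The scalar that cancels the coefficient at \<open>y^(s - 1)\<close>, which decides about the whole form.\<close>
    define k where "k = form_coeff m d (s - 1) / form_coeff m c (s - 1)"
    define e where "e = d - Polynomial.smult k c"
    have deg: "degree e = b"
    proof -
      have "degree (Polynomial.smult k c) < degree d"
        using c d ab by (metis degree_smult_le le_less_trans)
      then show ?thesis unfolding e_def using d
        by (metis degree_add_eq_left degree_minus diff_conv_add_uminus)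
    qed
    have "annihilated r s (Suc m) e"
      using c d eq m unfolding annihilated_def e_def
      by (simp add: form_coeff_diff form_coeff_smult)
    moreover have "form_coeff m e (s - 1) = 0"
      using nc by (simp add: e_def k_def form_coeff_diff form_coeff_smult)
    ultimately have "annihilated r s m e" using annihilated_pred deg bm by blast
    moreover have "e \<noteq> 0" using deg ab by auto
    ultimately show False using not_annihilated_below[of e m] deg bm m ab by auto
  qed
  then show ?thesis by (intro linorder_inj_onI) auto
qed

end

section \<open>Layered sequences\<close>

text \<open>
A sequence that rises by at most one per step cannot pass the value \<open>M l\<close> without attaining it, and
by injectivity it attains this value only at \<open>l\<close>.
\<close>

lemma no_crossing:
  fixes M :: "nat \<Rightarrow> nat"
  assumes inj: "inj_on M {..<r}" and step: "\<And>a. Suc a < r \<Longrightarrow> M (Suc a) \<le> Suc (M a)"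
    and le: "i \<le> j" "j < r" and start: "M i < M l" and l: "l < r" "l \<notin> {i..j}"
  shows "M j < M l"
  using le(1,2) l(2)
proof (induction j rule: dec_induct)
  case base
  show ?case by (rule start)
next
  case (step j)
  have "M (Suc j) \<le> Suc (M j)" using step assms(2) by simp
  moreover have "M j < M l" using step by auto
  moreover have "M (Suc j) \<noteq> M l" using inj_onD[OF inj, of "Suc j" l] step l by auto
  ultimately show ?case by simp
qed

text \<open>
For an injective sequence into \<open>{s..<r + s}\<close> rising by at most one, a drop at \<open>k\<close> separates all
earlier from all later values: by \<open>no_crossing\<close> the values from \<open>k\<close> onwards stay below \<open>M (k - 1)\<close>,
and an earlier value below one of them would have to pass it on the way up to \<open>M (k - 1)\<close>.
\<close>

lemma drop_iff_prefix:
  fixes M :: "nat \<Rightarrow> nat"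
  assumes inj: "inj_on M {..<r}" and step: "\<And>a. Suc a < r \<Longrightarrow> M (Suc a) \<le> Suc (M a)"
    and lower: "\<And>a. a < r \<Longrightarrow> s \<le> M a" and upper: "\<And>a. a < r \<Longrightarrow> M a < r + s"
    and k: "0 < k" "k < r"
  shows "M k < M (k - 1) \<longleftrightarrow> (\<forall>a<k. r + s - k \<le> M a)"
proof
  assume drop: "M k < M (k - 1)"
  have right: "M c < M (k - 1)" if "k \<le> c" "c < r" for c
    by (rule no_crossing[OF inj step that drop]) (use k in auto)
  show "\<forall>a<k. r + s - k \<le> M a"
  proof (intro allI impI)
    fix b assume b: "b < k"
    have "M c < M b" if c: "k \<le> c" "c < r" for c
    proof (rule ccontr)
      assume "\<not> M c < M b"
      moreover have "M c \<noteq> M b" using inj_onD[OF inj, of c b] b c k by auto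
      ultimately have "M b < M c" by simp
      then have "M (k - 1) < M c"
        by (intro no_crossing[OF inj step, of b "k - 1" c]) (use b c k in auto)
      then show False using right[OF c] by simp
    qed
    \<comment> \<open>Each of the first \<open>k\<close> values has \<open>r - k\<close> different values between \<open>s\<close> and itself.\<close>
    then have "M ` {k..<r} \<subseteq> {s..<M b}" using lower by auto
    then have "card (M ` {k..<r}) \<le> M b - s" by (metis card_atLeastLessThan card_mono finite_atLeastLessThan)
    moreover have "card (M ` {k..<r}) = r - k"
      by (subst card_image) (auto intro: inj_on_subset[OF inj])
    ultimately show "r + s - k \<le> M b" using lower[of b] b k by simp
  qed
next
  assume pre: "\<forall>a<k. r + s - k \<le> M a"
  have sub: "M ` {..<k} \<subseteq> {r + s - k..<r + s}" using pre upper k by auto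
  have "card (M ` {..<k}) = k" by (subst card_image) (use k in \<open>auto intro: inj_on_subset[OF inj]\<close>)
  then have eq: "M ` {..<k} = {r + s - k..<r + s}"
    by (intro card_subset_eq sub) (use k in auto)
  have "M k \<notin> M ` {..<k}" using inj_on_image_mem_iff[OF inj, of k "{..<k}"] k by auto
  then have "M k < r + s - k" using eq upper[of k] k by auto
  also have "\<dots> \<le> M (k - 1)" using pre k by simp
  finally show "M k < M (k - 1)" .
qed

section \<open>A binomial determinant and its prime divisors\<close>

lemma det_scale:
  fixes f g :: "nat \<Rightarrow> 'a::comm_ring_1"
  shows "det (mat n n (\<lambda>(i, j). f i * g j * h i j)) =
    (\<Prod>i<n. f i) * (\<Prod>j<n. g j) * det (mat n n (\<lambda>(i, j). h i j))"
proof -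
  let ?S = "{p. p permutes {0..<n}}"
  have "(\<Prod>i = 0..<n. f i * g (p i) * h i (p i)) =
      (\<Prod>i<n. f i) * (\<Prod>j<n. g j) * (\<Prod>i = 0..<n. h i (p i))" if "p \<in> ?S" for p
  proof -
    have "(\<Prod>i = 0..<n. g (p i)) = (\<Prod>j = 0..<n. g j)"
      using that by (metis (mono_tags) mem_Collect_eq permutes_imp_bij prod.reindex_bij_betw)
    then show ?thesis by (simp add: prod.distrib lessThan_atLeast0 mult_ac)
  qed
  moreover have "p i < n" if "p \<in> ?S" "i < n" for p i
    using that by (metis atLeastLessThan_iff mem_Collect_eq permutes_in_image zero_le)
  ultimately show ?thesis
    by (subst (1 2) det_def'[of _ n]) (auto simp: sum_distrib_left mult_ac intro!: sum.cong)
qed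

text \<open>
Vandermonde's convolution factors the matrix into two unitriangular matrices.
\<close>

lemma det_binomial_shift:
  "det (mat k k (\<lambda>(i, j). of_nat ((b + i) choose j))) = (1 :: 'a::idom)"
proof -
  let ?L = "mat k k (\<lambda>(i, l). of_nat (i choose l)) :: 'a mat"
  let ?U = "mat k k (\<lambda>(l, j). if l \<le> j then of_nat (b choose (j - l)) else 0) :: 'a mat"
  have "mat k k (\<lambda>(i, j). of_nat ((b + i) choose j)) = ?L * ?U"
  proof (rule eq_matI)
    fix i j assume ij: "i < dim_row (?L * ?U)" "j < dim_col (?L * ?U)"
    have "(b + i) choose j = (\<Sum>l\<le>j. (i choose l) * (b choose (j - l)))"
      using vandermonde[of i b j] by (simp add: add.commute)
    also have "of_nat \<dots> = (\<Sum>l\<le>j. of_nat (i choose l) * of_nat (b choose (j - l)) :: 'a)"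
      by simp
    also have "\<dots> = (\<Sum>l<k. of_nat (i choose l) * (if l \<le> j then of_nat (b choose (j - l)) else 0))"
      using ij by (intro sum.mono_neutral_cong_left) auto
    finally show "mat k k (\<lambda>(i, j). of_nat ((b + i) choose j)) $$ (i, j) = (?L * ?U) $$ (i, j)"
      using ij by (simp add: scalar_prod_def lessThan_atLeast0)
  qed simp_all
  moreover have "det ?L = 1"
    by (subst det_lower_triangular[of k]) (auto simp: prod_list_diag_prod binomial_eq_0)
  moreover have "det ?U = 1"
    by (subst det_upper_triangular[of _ k]) (auto simp: prod_list_diag_prod binomial_eq_0)
  ultimately show ?thesis by (simp add: det_mult[of _ k])
qed

text \<open>
By MacMahon's theorem this is the number of plane partitions in an \<open>a \<times> b \<times> k\<close> box.
\<close>

definition box_det :: "nat \<Rightarrow> nat \<Rightarrow> nat \<Rightarrow> int" where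
  "box_det a b k = det (mat k k (\<lambda>(i, j). int ((a + b + i) choose (a + j))))"

lemma fact_add_prod: "fact (m + b) = (fact m * (\<Prod>j<b. int (m + j + 1)))"
  by (induction b) (simp_all add: algebra_simps)

text \<open>
Up to scaling of rows and columns by factorials, the entry at \<open>(i, j)\<close> is the binomial coefficient
\<open>(b + i) choose j\<close>, and the matrix of these has determinant 1.
\<close>

lemma box_det_product:
  "box_det a b k * (\<Prod>i<k. \<Prod>j<b. int (i + j + 1)) = (\<Prod>i<k. \<Prod>j<b. int (a + i + j + 1))"
proof -
  let ?B = "\<lambda>i j. int ((a + b + i) choose (a + j))"
  have entry: "fact (b + i) * fact (a + j) * ?B i j = fact (a + b + i) * fact j * int ((b + i) choose j)"
    for i j
  proof (cases "j \<le> b + i")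
    case True
    have T: "fact (a + j) * fact (b + i - j) * ((a + b + i) choose (a + j)) = (fact (a + b + i) :: nat)"
      using binomial_fact_lemma[of "a + j" "a + b + i"] True by (simp add: add.assoc)
    have S: "fact j * fact (b + i - j) * ((b + i) choose j) = (fact (b + i) :: nat)"
      by (rule binomial_fact_lemma[OF True])
    have "fact (b + i) * fact (a + j) * ((a + b + i) choose (a + j)) =
        (fact (a + b + i) * fact j * ((b + i) choose j) :: nat)"
      by (subst S[symmetric], subst T[symmetric]) (simp only: mult_ac)
    then show ?thesis by (metis of_nat_fact of_nat_mult)
  qed (simp add: binomial_eq_0)
  have "(\<Prod>i<k. fact (b + i)) * (\<Prod>j<k. fact (a + j)) * box_det a b k =
      det (mat k k (\<lambda>(i, j). fact (b + i) * fact (a + j) * ?B i j))"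
    unfolding box_det_def by (rule det_scale[symmetric])
  also have "\<dots> = det (mat k k (\<lambda>(i, j). fact (a + b + i) * fact j * int ((b + i) choose j)))"
    by (simp only: entry)
  also have "\<dots> = (\<Prod>i<k. fact (a + b + i)) * (\<Prod>j<k. fact j)"
    by (subst det_scale) (simp add: det_binomial_shift)
  finally have "(\<Prod>i<k. fact (b + i)) * (\<Prod>j<k. fact (a + j)) * box_det a b k =
      (\<Prod>i<k. fact (a + b + i)) * (\<Prod>j<k. fact j)" .
  moreover have "(\<Prod>i<k. fact (b + i)) = (\<Prod>i<k. fact i) * (\<Prod>i<k. \<Prod>j<b. int (i + j + 1))"
    using fact_add_prod[of _ b] by (simp add: prod.distrib add_ac)
  moreover have "(\<Prod>i<k. fact (a + b + i)) =
      (\<Prod>i<k. fact (a + i)) * (\<Prod>i<k. \<Prod>j<b. int (a + i + j + 1))"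
    using fact_add_prod[of "a + i" b for i] by (simp add: prod.distrib add_ac)
  ultimately have "((\<Prod>i<k. fact i) * (\<Prod>j<k. fact (a + j))) *
        (box_det a b k * (\<Prod>i<k. \<Prod>j<b. int (i + j + 1))) =
      ((\<Prod>i<k. fact i) * (\<Prod>j<k. fact (a + j))) * (\<Prod>i<k. \<Prod>j<b. int (a + i + j + 1))"
    by (simp add: mult_ac)
  then show ?thesis by (subst (asm) mult_left_cancel) auto
qed

text \<open>
Powers of \<open>p\<close> up to \<open>p^m\<close> divide both numbers or none of them, and higher powers divide neither by
size.
\<close>

lemma multiplicity_eq_of_sum:
  fixes x y p :: nat
  assumes xy: "0 < x" "x < p ^ Suc m" "0 < y" "y < p ^ Suc m"
    and dvd: "p ^ m dvd x + y"
  shows "multiplicity (int p) (int x) = multiplicity (int p) (int y)"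
proof (rule multiplicity_cong)
  fix e
  have "p ^ e dvd x \<longleftrightarrow> p ^ e dvd y"
  proof (cases "e \<le> m")
    case True
    then have "p ^ e dvd x + y" using dvd le_imp_power_dvd dvd_trans by blast
    then show ?thesis by (metis dvd_add_right_iff dvd_add_left_iff)
  next
    case False
    then have "p ^ Suc m dvd p ^ e" by (intro le_imp_power_dvd) simp
    then have "\<not> p ^ e dvd x" "\<not> p ^ e dvd y" using xy by (meson dvd_imp_le dvd_trans leD)+
    then show ?thesis by simp
  qed
  then show "int p ^ e dvd int x \<longleftrightarrow> int p ^ e dvd int y"
    by (simp flip: of_nat_power)
qed

text \<open>
The products of \<open>i + j + 1\<close> for the two determinants agree after exchanging \<open>i\<close> and \<open>j\<close>. In the
numerators, the factor at \<open>(i, j)\<close> of the first and the factor at \<open>(k - 1 - i, b - 1 - j)\<close> of the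
second add up to \<open>a + a' + k + b\<close>.
\<close>

lemma dvd_box_det_symmetric:
  assumes p: "prime p" and dvd: "p ^ m dvd a + a' + k + b"
    and small: "a + k + b \<le> p ^ Suc m" "a' + k + b \<le> p ^ Suc m"
  shows "int p dvd box_det a b k \<longleftrightarrow> int p dvd box_det a' k b"
proof -
  let ?mu = "multiplicity (int p)"
  have pp: "prime_elem (int p)" using p by auto
  have split: "box_det c l n \<noteq> 0 \<and>
      ?mu (box_det c l n) + (\<Sum>i<n. \<Sum>j<l. ?mu (int (i + j + 1))) =
      (\<Sum>i<n. \<Sum>j<l. ?mu (int (c + i + j + 1)))" for c l n
  proof -
    have mult: "?mu (\<Prod>i<n. \<Prod>j<l. int (h i j + 1)) = (\<Sum>i<n. \<Sum>j<l. ?mu (int (h i j + 1)))"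
      for h :: "nat \<Rightarrow> nat \<Rightarrow> nat"
    proof -
      have "?mu (\<Prod>j<l. int (h i j + 1)) = (\<Sum>j<l. ?mu (int (h i j + 1)))" for i
        by (rule prime_elem_multiplicity_prod_distrib[OF pp]) auto
      moreover have "?mu (\<Prod>i<n. \<Prod>j<l. int (h i j + 1)) = (\<Sum>i<n. ?mu (\<Prod>j<l. int (h i j + 1)))"
        by (rule prime_elem_multiplicity_prod_distrib[OF pp])
           (auto simp: prod_zero_iff simp del: of_nat_add)
      ultimately show ?thesis by simp
    qed
    have prod_nz: "(\<Prod>i<n. \<Prod>j<l. int (h i j + 1)) \<noteq> 0" for h :: "nat \<Rightarrow> nat \<Rightarrow> nat"
      by (simp add: prod_zero_iff del: of_nat_add)
    have nz: "box_det c l n \<noteq> 0" 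
      using box_det_product[of c l n] prod_nz[of "\<lambda>i j. c + i + j"] by force
    have "?mu (box_det c l n * (\<Prod>i<n. \<Prod>j<l. int (i + j + 1))) =
        ?mu (box_det c l n) + ?mu (\<Prod>i<n. \<Prod>j<l. int (i + j + 1))"
      by (rule prime_elem_multiplicity_mult_distrib[OF pp nz prod_nz])
    then show ?thesis unfolding box_det_product mult using nz by simp
  qed
  have "(\<Sum>i<k. \<Sum>j<b. ?mu (int (a + i + j + 1))) =
      (\<Sum>i<k. \<Sum>j<b. ?mu (int (a' + (k - 1 - i) + (b - 1 - j) + 1)))"
  proof (intro sum.cong refl multiplicity_eq_of_sum[where m = m])
    fix i j assume ij: "i \<in> {..<k}" "j \<in> {..<b}"
    then have eq: "a + i + j + 1 + (a' + (k - 1 - i) + (b - 1 - j) + 1) = a + a' + k + b" by auto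
    then show "p ^ m dvd a + i + j + 1 + (a' + (k - 1 - i) + (b - 1 - j) + 1)" by (subst eq) (rule dvd)
  qed (use small in auto)
  also have "\<dots> = (\<Sum>i<k. \<Sum>j<b. ?mu (int (a' + (k - 1 - i) + j + 1)))"
    by (subst sum.nat_diff_reindex[symmetric]) simp
  also have "\<dots> = (\<Sum>i<k. \<Sum>j<b. ?mu (int (a' + i + j + 1)))"
    by (subst sum.nat_diff_reindex[symmetric]) simp
  also have "\<dots> = (\<Sum>j<b. \<Sum>i<k. ?mu (int (a' + j + i + 1)))"
    by (subst sum.swap) (simp add: add_ac)
  finally have "(\<Sum>i<k. \<Sum>j<b. ?mu (int (a + i + j + 1))) =
      (\<Sum>j<b. \<Sum>i<k. ?mu (int (a' + j + i + 1)))" .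
  moreover have "(\<Sum>i<k. \<Sum>j<b. ?mu (int (i + j + 1))) = (\<Sum>j<b. \<Sum>i<k. ?mu (int (j + i + 1)))"
    by (subst sum.swap) (simp add: add_ac)
  ultimately have "?mu (box_det a b k) = ?mu (box_det a' k b)"
    using split[where c=a and l=b and n=k] split[where c=a' and l=k and n=b] by linarith
  moreover have "\<not> is_unit (int p)" using p prime_elem_not_unit pp by blast
  ultimately show ?thesis
    using split[where c=a and l=b and n=k] split[where c=a' and l=k and n=b] by (metis multiplicity_eq_zero_iff)
qed

section \<open>Drops of the lengths\<close>

text \<open>
Vanishing of a form of degree \<open>r + s - 1 - k\<close> divisible by \<open>l^(r + s - 2 k)\<close> is a system of \<open>k\<close>
linear equations, one for each \<open>y^u\<close> with \<open>s - k \<le> u < s\<close>, in the \<open>k\<close> coefficients of its encoding.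
Listing the unknowns in reverse order makes its matrix the transpose of the one defining
\<open>box_det (s - k) (r - k) k\<close>.
\<close>

lemma no_annihilated_form_iff_box_det:
  assumes k: "0 < k" "k < r" "r \<le> s"
  shows "(\<forall>c :: 'a::field poly. degree c < k \<and> annihilated r s (r + s - 1 - k) c \<longrightarrow> c = 0) \<longleftrightarrow>
    of_int (box_det (s - k) (r - k) k) \<noteq> (0 :: 'a)"
proof -
  let ?m = "r + s - 1 - k"
  let ?Z = "mat k k (\<lambda>(i, j). int ((s - k + (r - k) + i) choose (s - k + j)))"
  let ?B = "(map_mat of_int ?Z)\<^sup>T :: 'a mat"
  have B: "?B \<in> carrier_mat k k" by simp
  have det: "det ?B = of_int (box_det (s - k) (r - k) k)"
    unfolding box_det_def by (subst det_transpose[of _ k]) simp_all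
  have mult: "(?B *\<^sub>v vec k (\<lambda>i. coeff c (k - 1 - i))) $ j = form_coeff ?m c (s - k + j)"
    if c: "degree c < k" and j: "j < k" for c :: "'a poly" and j
  proof -
    have "form_coeff ?m c (s - k + j) = (\<Sum>i<k. coeff c i * of_nat ((?m - i) choose (s - k + j)))"
      unfolding form_coeff_def
      by (rule sum.mono_neutral_right) (use c k in \<open>auto simp: coeff_eq_0\<close>)
    also have "\<dots> = (\<Sum>i<k. coeff c (k - 1 - i) * of_nat ((?m - (k - 1 - i)) choose (s - k + j)))"
      by (subst sum.nat_diff_reindex[symmetric]) simp
    also have "\<dots> = (\<Sum>i<k. of_nat ((s - k + (r - k) + i) choose (s - k + j)) * coeff c (k - 1 - i))"
    proof (rule sum.cong)
      fix i assume "i \<in> {..<k}"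
      then have "?m - (k - 1 - i) = s - k + (r - k) + i" using k by auto
      then show "coeff c (k - 1 - i) * of_nat ((?m - (k - 1 - i)) choose (s - k + j)) =
          of_nat ((s - k + (r - k) + i) choose (s - k + j)) * coeff c (k - 1 - i)" by simp
    qed simp
    finally show ?thesis using j by (simp add: scalar_prod_def lessThan_atLeast0)
  qed
  have ann: "annihilated r s ?m c \<longleftrightarrow> ?B *\<^sub>v vec k (\<lambda>i. coeff c (k - 1 - i)) = 0\<^sub>v k"
    if c: "degree c < k" for c :: "'a poly"
  proof -
    have "annihilated r s ?m c \<longleftrightarrow> (\<forall>j<k. form_coeff ?m c (s - k + j) = 0)"
      unfolding annihilated_def
    proof safe
      fix u assume *: "\<forall>j<k. form_coeff ?m c (s - k + j) = 0" "u < s" "?m < r + u"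
      from *(1)[rule_format, of "u - (s - k)"] *(2,3) k show "form_coeff ?m c u = 0" by auto
    qed (use k in auto)
    also have "\<dots> \<longleftrightarrow> ?B *\<^sub>v vec k (\<lambda>i. coeff c (k - 1 - i)) = 0\<^sub>v k"
      using mult[OF c] by (auto simp: vec_eq_iff simp del: index_mult_mat_vec)
    finally show ?thesis .
  qed
  show ?thesis
  proof (cases "det ?B = 0")
    case True
    then obtain v where v: "v \<in> carrier_vec k" "v \<noteq> 0\<^sub>v k" "?B *\<^sub>v v = 0\<^sub>v k"
      using det_0_iff_vec_prod_zero[OF B] by blast
    define c where "c = (\<Sum>i<k. monom (v $ (k - 1 - i)) i)"
    have coeff: "coeff c i = (if i < k then v $ (k - 1 - i) else 0)" for i
      by (simp add: c_def coeff_sum)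
    have deg: "degree c < k"
      using k(1) coeff by (intro degree_lessI) auto
    have "vec k (\<lambda>i. coeff c (k - 1 - i)) = v" using v(1) by (auto simp: coeff)
    then have "annihilated r s ?m c" "c \<noteq> 0" using ann[OF deg] v by auto
    with True deg det show ?thesis by auto
  next
    case False
    have "c = 0" if c: "degree c < k" "annihilated r s ?m c" for c :: "'a poly"
    proof -
      have "vec k (\<lambda>i. coeff c (k - 1 - i)) = 0\<^sub>v k"
        using False det_0_iff_vec_prod_zero[OF B] ann[OF c(1)] c(2) vec_carrier by blast
      then have z: "coeff c (k - 1 - i) = 0" if "i < k" for i
        using that by (metis index_vec index_zero_vec(1))
      have "coeff c i = 0" for i
        using z[of "k - 1 - i"] c(1) by (cases "i < k") (auto simp: coeff_eq_0)
      then show "c = 0" by (simp add: poly_eq_iff)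
    qed
    with False det show ?thesis by auto
  qed
qed

text \<open>
A nonzero polynomial of degree \<open>a < k\<close> annihilated in degree \<open>r + s - 1 - k\<close> bounds \<open>M a\<close> by this
degree. Conversely, such a bound yields one, because annihilation persists in higher degrees.
\<close>

lemma prefix_iff_box_det:
  fixes F :: "'a::field itself"
  assumes k: "0 < k" "k < r" "r \<le> s"
  shows "(\<forall>a<k. r + s - k \<le> annihilation_degree F r s a) \<longleftrightarrow>
    of_int (box_det (s - k) (r - k) k) \<noteq> (0 :: 'a)"
proof -
  let ?m = "r + s - 1 - k"
  have "(\<forall>a<k. r + s - k \<le> annihilation_degree F r s a) \<longleftrightarrow>
      (\<forall>c :: 'a poly. degree c < k \<and> annihilated r s ?m c \<longrightarrow> c = 0)"
  proof safe
    fix c :: "'a poly"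
    assume *: "\<forall>a<k. r + s - k \<le> annihilation_degree F r s a" "degree c < k" "annihilated r s ?m c"
    show "c = 0"
    proof (rule ccontr)
      assume "c \<noteq> 0"
      then have "annihilation_degree F r s (degree c) \<le> ?m"
        using * k by (intro annihilation_degree_le) auto
      then show False using *(1,2) k by fastforce
    qed
  next
    fix a assume *: "\<forall>c :: 'a poly. degree c < k \<and> annihilated r s ?m c \<longrightarrow> c = 0" "a < k"
    show "r + s - k \<le> annihilation_degree F r s a"
    proof (rule ccontr)
      assume "\<not> ?thesis"
      then have le: "annihilation_degree F r s a \<le> ?m" by simp
      have "a < r" using * k by simp
      then obtain c :: "'a poly" where "c \<noteq> 0" "degree c = a" "a \<le> annihilation_degree F r s a"
          "annihilated r s (annihilation_degree F r s a) c"
        using annihilation_degree_witness[OF k(3)] by metis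
      then show False using *(1) annihilated_mono[OF _ _ le] \<open>a < k\<close> by blast
    qed
  qed
  then show ?thesis using no_annihilated_form_iff_box_det[OF k, where 'a='a] by simp
qed

definition jordan_length :: "'a::field itself \<Rightarrow> nat \<Rightarrow> nat \<Rightarrow> nat \<Rightarrow> nat" where
  "jordan_length F r s a = annihilation_degree F r s a - a"

context
  fixes r s :: nat and F :: "'a::field itself"
  assumes rs: "r \<le> s"
begin

lemma jordan_length_pos: "a < r \<Longrightarrow> 0 < jordan_length F r s a"
  using annihilation_degree_ge[OF rs, of a F] rs unfolding jordan_length_def by simp

lemma jordan_length_Suc_le: "Suc a < r \<Longrightarrow> jordan_length F r s (Suc a) \<le> jordan_length F r s a"
  using annihilation_degree_Suc[OF rs, of a F] unfolding jordan_length_def by simp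

text \<open>
The annihilation degrees exhaust \<open>{s..<r + s}\<close>, so the lengths sum up as if \<open>M a\<close> were \<open>a + s\<close>.
\<close>

lemma sum_jordan_length: "(\<Sum>a<r. jordan_length F r s a) = r * s"
proof -
  let ?M = "annihilation_degree F r s"
  have sub: "?M ` {..<r} \<subseteq> {s..<r + s}"
    using annihilation_degree_ge[OF rs] annihilation_degree_less[OF rs] by auto
  have "card (?M ` {..<r}) = r" by (subst card_image) (auto intro: annihilation_degree_inj[OF rs])
  then have img: "?M ` {..<r} = {s..<r + s}" by (intro card_subset_eq sub) auto
  have "(\<Sum>a<r. ?M a) = \<Sum>{s..<r + s}"
    unfolding img[symmetric] by (simp add: sum.reindex[OF annihilation_degree_inj[OF rs]])
  also have "\<dots> = (\<Sum>a<r. a + s)"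
    using sum.shift_bounds_nat_ivl[of "\<lambda>x. x" 0 s r] by (simp add: lessThan_atLeast0)
  finally have "(\<Sum>a<r. ?M a) = (\<Sum>a<r. a) + r * s" by (simp add: sum.distrib)
  moreover have "(\<Sum>a<r. ?M a) = (\<Sum>a<r. jordan_length F r s a) + (\<Sum>a<r. a)"
    unfolding sum.distrib[symmetric]
    using annihilation_degree_ge[OF rs, of _ F] rs
    by (intro sum.cong) (fastforce simp: jordan_length_def)+
  ultimately show ?thesis by simp
qed

lemma jordan_length_drop_iff:
  assumes k: "0 < k" "k < r"
  shows "jordan_length F r s k < jordan_length F r s (k - 1) \<longleftrightarrow>
    of_int (box_det (s - k) (r - k) k) \<noteq> (0 :: 'a)"
proof -
  let ?M = "annihilation_degree F r s"
  have k1: "k - 1 < r" using k by simp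
  then have "s \<le> ?M (k - 1)" "s \<le> ?M k" using annihilation_degree_ge[OF rs] k by blast+
  then have "k - 1 < ?M (k - 1)" "k < ?M k" using k rs by linarith+
  moreover have "?M k \<noteq> ?M (k - 1)"
    using inj_onD[OF annihilation_degree_inj[OF rs, of F], of k "k - 1"] k k1 by auto
  ultimately have "jordan_length F r s k < jordan_length F r s (k - 1) \<longleftrightarrow> ?M k < ?M (k - 1)"
    unfolding jordan_length_def by linarith
  also have "\<dots> \<longleftrightarrow> (\<forall>a<k. r + s - k \<le> ?M a)"
    by (rule drop_iff_prefix[OF annihilation_degree_inj[OF rs]])
       (use k annihilation_degree_Suc[OF rs] annihilation_degree_ge[OF rs]
          annihilation_degree_less[OF rs] in auto)
  also have "\<dots> \<longleftrightarrow> of_int (box_det (s - k) (r - k) k) \<noteq> (0 :: 'a)"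
    by (rule prefix_iff_box_det[OF k rs])
  finally show ?thesis .
qed

end

section \<open>Jordan matrices from Jordan chains\<close>

text \<open>
The matrix whose columns are the chains \<open>v a 0, ..., v a (l a - 1)\<close> for \<open>a\<close> in the list, one chain
after the other. It is assembled from blocks so that it can be multiplied with the block diagonal
\<open>jordan_matrix\<close>; the lower blocks have no rows.
\<close>

primrec chain_mat :: "nat \<Rightarrow> ('b \<Rightarrow> nat) \<Rightarrow> ('b \<Rightarrow> nat \<Rightarrow> 'a::field vec) \<Rightarrow> 'b list \<Rightarrow> 'a mat" where
  "chain_mat n l v [] = 0\<^sub>m n 0"
| "chain_mat n l v (a # as) =
     four_block_mat (mat n (l a) (\<lambda>(i, j). v a j $ i)) (chain_mat n l v as)
       (0\<^sub>m 0 (l a)) (0\<^sub>m 0 (sum_list (map l as)))"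

lemma chain_mat_carrier: "chain_mat n l v as \<in> carrier_mat n (sum_list (map l as))"
proof (induction as)
  case (Cons a as)
  from four_block_carrier_mat[of "mat n (l a) (\<lambda>(i, j). v a j $ i)" n "l a" "0\<^sub>m 0 _" 0 "sum_list (map l as)"]
  show ?case by simp
qed simp

lemma sum_mult_jordan_block:
  fixes f :: "nat \<Rightarrow> 'a::comm_ring_1"
  assumes "j < n"
  shows "(\<Sum>k<n. f k * jordan_block n e $$ (k, j)) = e * f j + (if j = 0 then 0 else f (j - 1))"
proof -
  have "(\<Sum>k<n. f k * jordan_block n e $$ (k, j)) =
      (\<Sum>k<n. if k = j then e * f k else 0) + (\<Sum>k<n. if Suc k = j then f k else 0)"
    unfolding sum.distrib[symmetric] using assms by (intro sum.cong) auto
  moreover have "(\<Sum>k<n. if Suc k = j then f k else 0) = (if j = 0 then 0 else f (j - 1))"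
    using assms by (cases j) simp_all
  ultimately show ?thesis using assms by simp
qed

lemma jordan_block_mult_sum:
  fixes f :: "nat \<Rightarrow> 'a::comm_ring_1"
  assumes "i < n"
  shows "(\<Sum>k<n. jordan_block n e $$ (i, k) * f k) = e * f i + (if Suc i < n then f (Suc i) else 0)"
proof -
  have "(\<Sum>k<n. jordan_block n e $$ (i, k) * f k) =
      (\<Sum>k<n. if k = i then e * f k else 0) + (\<Sum>k<n. if k = Suc i then f k else 0)"
    unfolding sum.distrib[symmetric] using assms by (intro sum.cong) auto
  then show ?thesis using assms by simp
qed

lemma mult_chain_mat:
  assumes A: "A \<in> carrier_mat n n"
    and v: "\<And>a j. a \<in> set as \<Longrightarrow> j < l a \<Longrightarrow> v a j \<in> carrier_vec n"
    and chain: "\<And>a j. a \<in> set as \<Longrightarrow> j < l a \<Longrightarrow>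
      A *\<^sub>v v a j = e \<cdot>\<^sub>v v a j + (if j = 0 then 0\<^sub>v n else v a (j - 1))"
  shows "A * chain_mat n l v as = chain_mat n l v as * jordan_matrix (map (\<lambda>a. (l a, e)) as)"
  using v chain
proof (induction as)
  case Nil
  then show ?case using A by (auto simp: jordan_matrix_def intro!: eq_matI)
next
  case (Cons a as)
  let ?P = "mat n (l a) (\<lambda>(i, j). v a j $ i)" and ?C = "chain_mat n l v as"
  let ?m = "sum_list (map l as)"
  let ?J = "jordan_matrix (map (\<lambda>a. (l a, e)) as)"
  have C: "?C \<in> carrier_mat n ?m" by (rule chain_mat_carrier)
  have J: "?J \<in> carrier_mat ?m ?m"
    using jordan_matrix_carrier[of "map (\<lambda>a. (l a, e)) as"] by (simp add: comp_def)
  have IH: "A * ?C = ?C * ?J" using Cons.IH Cons.prems by simp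
  have block: "A * ?P = ?P * jordan_block (l a) e"
  proof (rule eq_matI)
    fix i j assume "i < dim_row (?P * jordan_block (l a) e)" "j < dim_col (?P * jordan_block (l a) e)"
    then have ij: "i < n" "j < l a" by simp_all
    have "col ?P j = v a j" using Cons.prems(1)[of a j] ij by auto
    then have "(A * ?P) $$ (i, j) = (A *\<^sub>v v a j) $ i" using A ij by simp
    also have "\<dots> = e * v a j $ i + (if j = 0 then 0 else v a (j - 1) $ i)"
    proof -
      have "dim_vec (v a j) = n" "dim_vec (v a (j - 1)) = n"
        using Cons.prems(1)[of a j] Cons.prems(1)[of a "j - 1"] ij by auto
      then show ?thesis using ij by (subst Cons.prems(2)) auto
    qed
    also have "\<dots> = (\<Sum>k<l a. v a k $ i * jordan_block (l a) e $$ (k, j))"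
      by (rule sum_mult_jordan_block[OF ij(2), symmetric])
    also have "\<dots> = (?P * jordan_block (l a) e) $$ (i, j)"
      using ij by (simp add: scalar_prod_def lessThan_atLeast0)
    finally show "(A * ?P) $$ (i, j) = (?P * jordan_block (l a) e) $$ (i, j)" .
  qed (use A in simp_all)
  \<comment> \<open>Empty blocks around \<open>A\<close> make the block product applicable.\<close>
  have Ab: "A = four_block_mat A (0\<^sub>m n 0) (0\<^sub>m 0 n) (0\<^sub>m 0 0)"
    using A by (intro eq_matI) auto
  have "A * chain_mat n l v (a # as) =
      four_block_mat (A * ?P) (A * ?C) (0\<^sub>m 0 (l a)) (0\<^sub>m 0 ?m)"
    by (subst Ab, unfold chain_mat.simps, subst mult_four_block_mat[of _ n n _ 0 _ 0])
       (use A C in \<open>auto intro!: arg_cong2[where f = "\<lambda>X Y. four_block_mat X Y _ _"]\<close>)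
  moreover have "jordan_matrix (map (\<lambda>a. (l a, e)) (a # as)) =
      four_block_mat (jordan_block (l a) e) (0\<^sub>m (l a) ?m) (0\<^sub>m ?m (l a)) ?J"
    using carrier_matD[OF J] by (simp add: jordan_matrix_def Let_def)
  moreover have "?P * jordan_block (l a) e + 0\<^sub>m n (l a) = ?P * jordan_block (l a) e"
      "0\<^sub>m 0 ?m * ?J = 0\<^sub>m 0 ?m"
    using J by (auto intro!: eq_matI)
  then have "chain_mat n l v (a # as) *
        four_block_mat (jordan_block (l a) e) (0\<^sub>m (l a) ?m) (0\<^sub>m ?m (l a)) ?J =
      four_block_mat (?P * jordan_block (l a) e) (?C * ?J) (0\<^sub>m 0 (l a)) (0\<^sub>m 0 ?m)"
    unfolding chain_mat.simps
    by (subst mult_four_block_mat[of _ n "l a" _ ?m _ 0 _ _ "l a" _ ?m])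
       (use C J in auto)
  ultimately show ?case by (simp only: block IH)
qed

text \<open>
The entries of \<open>w\<close> are merely renamed to a family \<open>W\<close> indexed by chain and position.
\<close>

lemma chain_mat_mult_vec:
  assumes "distinct as" "w \<in> carrier_vec (sum_list (map l as))"
  obtains W where
    "\<And>i. i < n \<Longrightarrow> (chain_mat n l v as *\<^sub>v w) $ i = (\<Sum>a\<in>set as. \<Sum>j<l a. W a j * v a j $ i)"
    "(\<And>a j. a \<in> set as \<Longrightarrow> j < l a \<Longrightarrow> W a j = 0) \<Longrightarrow> w = 0\<^sub>v (sum_list (map l as))"
  using assms
proof (induction as arbitrary: w thesis)
  case Nil
  show ?case by (rule Nil.prems(1)[of "\<lambda>_ _. 0"]) (use Nil.prems(3) in \<open>auto simp: scalar_prod_def\<close>)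
next
  case (Cons a as)
  let ?m = "sum_list (map l as)" and ?P = "mat n (l a) (\<lambda>(i, j). v a j $ i)"
  define x y where "x = vec_first w (l a)" and "y = vec_last w ?m"
  have xy: "x \<in> carrier_vec (l a)" "y \<in> carrier_vec ?m" "w = x @\<^sub>v y"
    using Cons.prems(3) by (auto simp: x_def y_def)
  obtain W where W: "\<And>i. i < n \<Longrightarrow>
        (chain_mat n l v as *\<^sub>v y) $ i = (\<Sum>a\<in>set as. \<Sum>j<l a. W a j * v a j $ i)"
      "(\<And>a j. a \<in> set as \<Longrightarrow> j < l a \<Longrightarrow> W a j = 0) \<Longrightarrow> y = 0\<^sub>v ?m"
    using Cons.IH[OF _ _ xy(2)] Cons.prems(2) by auto
  define W' where "W' = W(a := \<lambda>j. x $ j)"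
  show ?case
  proof (rule Cons.prems(1)[of W'])
    fix i assume i: "i < n"
    have "(chain_mat n l v (a # as) *\<^sub>v w) $ i = (?P *\<^sub>v x) $ i + (chain_mat n l v as *\<^sub>v y) $ i"
      unfolding xy(3) chain_mat.simps
      using i xy chain_mat_carrier[of n l v as]
      by (subst four_block_mat_mult_vec[of _ n "l a" _ ?m _ 0]) auto
    also have "(?P *\<^sub>v x) $ i = (\<Sum>j<l a. W' a j * v a j $ i)"
      using i xy(1) by (auto simp: scalar_prod_def lessThan_atLeast0 W'_def mult.commute intro!: sum.cong)
    also have "(chain_mat n l v as *\<^sub>v y) $ i = (\<Sum>a\<in>set as. \<Sum>j<l a. W' a j * v a j $ i)"
      unfolding W(1)[OF i] using Cons.prems(2) by (intro sum.cong) (auto simp: W'_def)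
    finally show "(chain_mat n l v (a # as) *\<^sub>v w) $ i =
        (\<Sum>a\<in>set (a # as). \<Sum>j<l a. W' a j * v a j $ i)"
      using Cons.prems(2) by simp
  next
    assume 0: "W' b j = 0" if "b \<in> set (a # as)" "j < l b" for b j
    have "x = 0\<^sub>v (l a)" using xy(1) 0[of a] by (auto simp: W'_def)
    moreover have "y = 0\<^sub>v ?m"
    proof (rule W(2))
      fix b j assume "b \<in> set as" "j < l b"
      then show "W b j = 0" using 0[of b j] Cons.prems(2) by (cases "b = a") (auto simp: W'_def)
    qed
    ultimately show "w = 0\<^sub>v (sum_list (map l (a # as)))" unfolding xy(3) by auto
  qed
qed

text \<open>
Linearly independent Jordan chains of full total length are the columns of an invertible matrix
conjugating \<open>A\<close> into Jordan form.
\<close>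

lemma similar_mat_jordan_matrix_of_chains:
  fixes A :: "'a::field mat"
  assumes A: "A \<in> carrier_mat n n" and as: "distinct as" "sum_list (map l as) = n"
    and v: "\<And>a j. a \<in> set as \<Longrightarrow> j < l a \<Longrightarrow> v a j \<in> carrier_vec n"
    and chain: "\<And>a j. a \<in> set as \<Longrightarrow> j < l a \<Longrightarrow>
      A *\<^sub>v v a j = e \<cdot>\<^sub>v v a j + (if j = 0 then 0\<^sub>v n else v a (j - 1))"
    and indep: "\<And>W a j. (\<And>i. i < n \<Longrightarrow> (\<Sum>a\<in>set as. \<Sum>j<l a. W a j * v a j $ i) = 0) \<Longrightarrow>
      a \<in> set as \<Longrightarrow> j < l a \<Longrightarrow> W a j = 0"
  shows "similar_mat A (jordan_matrix (map (\<lambda>a. (l a, e)) as))"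
proof -
  let ?P = "chain_mat n l v as" and ?J = "jordan_matrix (map (\<lambda>a. (l a, e)) as)"
  have P: "?P \<in> carrier_mat n n" using chain_mat_carrier[of n l v as] as(2) by simp
  have J: "?J \<in> carrier_mat n n"
    using jordan_matrix_carrier[of "map (\<lambda>a. (l a, e)) as"] as(2) by (simp add: comp_def)
  have "det ?P \<noteq> 0"
  proof
    assume "det ?P = 0"
    then obtain w where w: "w \<in> carrier_vec n" "w \<noteq> 0\<^sub>v n" "?P *\<^sub>v w = 0\<^sub>v n"
      using det_0_iff_vec_prod_zero[OF P] by blast
    obtain W where W: "\<And>i. i < n \<Longrightarrow> (?P *\<^sub>v w) $ i = (\<Sum>a\<in>set as. \<Sum>j<l a. W a j * v a j $ i)"
      "(\<And>a j. a \<in> set as \<Longrightarrow> j < l a \<Longrightarrow> W a j = 0) \<Longrightarrow> w = 0\<^sub>v n"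
      using chain_mat_mult_vec[OF as(1), of w l n v, unfolded as(2), OF w(1)] by blast
    have "W a j = 0" if "a \<in> set as" "j < l a" for a j
      by (rule indep[OF _ that]) (use W(1) w(3) in simp)
    then show False using W(2) w(2) by blast
  qed
  from det_non_zero_imp_unit[OF P this, of "()"] obtain Q where
    Q: "Q \<in> carrier_mat n n" "?P * Q = 1\<^sub>m n" "Q * ?P = 1\<^sub>m n"
    by (auto simp: Units_def ring_mat_def)
  have AP: "A * ?P = ?P * ?J" by (rule mult_chain_mat[OF A v chain])
  have "A = A * (?P * Q)" using A Q by simp
  also have "\<dots> = ?P * ?J * Q" using A P Q AP by (metis assoc_mult_mat)
  finally show ?thesis using A P Q J by (intro similar_matI[of _ _ ?P Q n]) auto
qed

section \<open>Jordan chains of the Kronecker product\<close>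

text \<open>
The polynomial whose coefficient at \<open>y^u\<close> is the polynomial \<open>f u\<close> in \<open>x\<close>, as a vector. The nilpotent
part of a Jordan block maps the basis vector with index \<open>i\<close> to the one with index \<open>i - 1\<close>, so multiplication by \<open>x\<close> and \<open>y\<close>
must lower the indices, and the exponents are numbered backwards.
\<close>

definition tensor_vec :: "nat \<Rightarrow> nat \<Rightarrow> (nat \<Rightarrow> 'a::field poly) \<Rightarrow> 'a vec" where
  "tensor_vec r s f = vec (r * s) (\<lambda>k. coeff (f (s - 1 - k mod s)) (r - 1 - k div s))"

lemma sum_div_mod:
  fixes h :: "nat \<Rightarrow> 'a::comm_monoid_add"
  shows "(\<Sum>x<r * s. h x) = (\<Sum>a<r. \<Sum>b<s. h (a * s + b))"
proof -
  have "sum h {a * s..<a * s + s} = (\<Sum>b<s. h (a * s + b))" for a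
    using sum.shift_bounds_nat_ivl[of h 0 "a * s" s] by (simp add: add.commute lessThan_atLeast0)
  then show ?thesis by (simp flip: sum.nat_group)
qed

text \<open>
The Kronecker product acts as multiplication by \<open>(1 + x)(1 + y)\<close>.
\<close>

lemma kronecker_mult_tensor_vec:
  "kronecker_product (jordan_block r (1::'a::field)) (jordan_block s 1) *\<^sub>v tensor_vec r s f =
     tensor_vec r s (\<lambda>u. [:1, 1:] * (f u + (if u = 0 then 0 else f (u - 1))))"
proof (rule eq_vecI)
  let ?J = "\<lambda>n. jordan_block n (1::'a)"
  fix k assume "k < dim_vec (tensor_vec r s (\<lambda>u. [:1, 1:] * (f u + (if u = 0 then 0 else f (u - 1)))))"
  then have k: "k < r * s" by (simp add: tensor_vec_def)
  then have s: "0 < s" by (cases s) auto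
  define i j where "i = k div s" and "j = k mod s"
  have ij: "i < r" "j < s" using k s by (auto simp: i_def j_def less_mult_imp_div_less)
  define g where "g = (\<lambda>u. f u + (if u = 0 then 0 else f (u - 1)))"
  have row: "(\<Sum>b<s. ?J s $$ (j, b) * coeff (f (s - 1 - b)) t) = coeff (g (s - 1 - j)) t" for t
    using ij by (subst jordan_block_mult_sum) (auto simp: g_def)
  have "(kronecker_product (?J r) (?J s) *\<^sub>v tensor_vec r s f) $ k =
      (\<Sum>x<r * s. (?J r $$ (i, x div s) * ?J s $$ (j, x mod s)) * coeff (f (s - 1 - x mod s)) (r - 1 - x div s))"
    using k by (simp add: kronecker_product_def scalar_prod_def tensor_vec_def lessThan_atLeast0 i_def j_def)
  also have "\<dots> = (\<Sum>a<r. \<Sum>b<s. (?J r $$ (i, a) * ?J s $$ (j, b)) * coeff (f (s - 1 - b)) (r - 1 - a))"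
    by (subst sum_div_mod) simp
  also have "\<dots> = (\<Sum>a<r. ?J r $$ (i, a) * coeff (g (s - 1 - j)) (r - 1 - a))"
    by (simp only: row[symmetric] sum_distrib_left mult.assoc)
  also have "\<dots> = coeff ([:1, 1:] * g (s - 1 - j)) (r - 1 - i)"
    using ij by (subst jordan_block_mult_sum) (auto simp: coeff_pCons split: nat.splits intro!: arg_cong[where f = "coeff _"])
  finally show "(kronecker_product (?J r) (?J s) *\<^sub>v tensor_vec r s f) $ k =
      tensor_vec r s (\<lambda>u. [:1, 1:] * (f u + (if u = 0 then 0 else f (u - 1)))) $ k"
    using k by (simp add: tensor_vec_def g_def i_def j_def)
qed (simp add: tensor_vec_def kronecker_product_def)

text \<open>
The part at \<open>y^u\<close> of the form of degree \<open>m\<close> encoded by \<open>c\<close>, after substituting \<open>(1 + x) y\<close> for \<open>y\<close>.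
\<close>

definition form_row :: "nat \<Rightarrow> 'a::field poly \<Rightarrow> nat \<Rightarrow> 'a poly" where
  "form_row m c u = Polynomial.smult (form_coeff m c u) ([:0, 1:] ^ (m - u) * [:1, 1:] ^ u)"

text \<open>
After the substitution, \<open>(1 + x)(1 + y)\<close> has become \<open>1 + x + y = 1 + l\<close>, so a form is mapped to the
sum of itself and its product with \<open>l\<close>.
\<close>

lemma form_row_step:
  assumes "degree c \<le> m"
  shows "[:1, 1:] * (form_row m c u + (if u = 0 then 0 else form_row m c (u - 1))) =
    form_row m c u + form_row (Suc m) c u"
proof (cases u)
  case 0
  then show ?thesis
    using form_coeff_Suc[OF assms, of 0] by (simp add: form_row_def smult_add_right)
next
  case (Suc u')
  show ?thesis
  proof (cases "u \<le> m")
    case True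
    then obtain d where m: "m = u + d" using le_Suc_ex by blast
    define X Y where "X = [:0, 1 :: 'a:]" and "Y = [:1, 1 :: 'a:]"
    define e e' where "e = [:form_coeff m c u:]" and "e' = [:form_coeff m c u':]"
    have YX: "Y = 1 + X" by (simp add: X_def Y_def one_pCons)
    have f: "form_row m c u = e * (X ^ d * Y ^ Suc u')" "form_row m c u' = e' * (X ^ Suc d * Y ^ u')"
      "form_row (Suc m) c u = (e + e') * (X ^ Suc d * Y ^ Suc u')"
      using m Suc form_coeff_Suc[OF assms, of u]
      by (simp_all add: form_row_def X_def Y_def e_def e'_def Suc_diff_le)
    have "Y * (e * (X ^ d * Y ^ Suc u') + e' * (X ^ Suc d * Y ^ u')) =
        e * (X ^ d * Y ^ Suc u') + (e + e') * (X ^ Suc d * Y ^ Suc u')"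
      unfolding power_Suc YX by (simp add: algebra_simps)
    then have "Y * (form_row m c u + form_row m c u') = form_row m c u + form_row (Suc m) c u"
      by (simp only: f)
    moreover have "u \<noteq> 0" "u - 1 = u'" using Suc by simp_all
    ultimately show ?thesis by (simp only: Y_def if_False)
  next
    case False
    then have "form_coeff m c u = 0" by (intro form_coeff_eq_0) simp
    moreover have "m = u' \<or> form_coeff m c u' = 0" using False Suc by (auto intro: form_coeff_eq_0)
    ultimately show ?thesis
      using Suc form_coeff_Suc[OF assms, of u] False by (auto simp: form_row_def mult_ac)
  qed
qed

definition form_vec :: "nat \<Rightarrow> nat \<Rightarrow> nat \<Rightarrow> 'a::field poly \<Rightarrow> 'a vec" where
  "form_vec r s m c = tensor_vec r s (form_row m c)"

lemma kronecker_mult_form_vec: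
  assumes "degree c \<le> m"
  shows "kronecker_product (jordan_block r (1::'a::field)) (jordan_block s 1) *\<^sub>v form_vec r s m c =
    form_vec r s m c + form_vec r s (Suc m) c"
  unfolding form_vec_def kronecker_mult_tensor_vec form_row_step[OF assms]
  by (rule eq_vecI) (simp_all add: tensor_vec_def)

lemma form_vec_eq_0:
  assumes "annihilated r s m c"
  shows "form_vec r s m c = 0\<^sub>v (r * s)"
proof (rule eq_vecI)
  fix k assume "k < dim_vec (0\<^sub>v (r * s))"
  then have k: "k < r * s" by simp
  define u t where "u = s - 1 - k mod s" and "t = r - 1 - k div s"
  have "0 < r" "0 < s" using k by (auto intro: gr0I)
  then have ut: "u < s" "t < r" by (auto simp: u_def t_def)
  have "coeff (form_row m c u) t = 0"
  proof (cases "form_coeff m c u = 0")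
    case False
    then have "u \<le> m" "r + u \<le> m"
      using form_coeff_eq_0[of m u c] assms ut unfolding annihilated_def by (auto simp: not_less)
    moreover have "[:0, 1:] ^ (m - u) = monom (1 :: 'a) (m - u)" by (simp add: monom_altdef)
    ultimately show ?thesis using ut by (simp add: form_row_def coeff_monom_mult)
  qed (simp add: form_row_def)
  then show "form_vec r s m c $ k = 0\<^sub>v (r * s) $ k"
    using k by (simp add: form_vec_def tensor_vec_def u_def t_def)
qed (simp add: form_vec_def tensor_vec_def)

text \<open>
The factor \<open>(1 + x)^u\<close> introduced by the substitution is a unit modulo \<open>x^r\<close>.
\<close>

lemma coeff_0_of_one_plus_X_power:
  fixes q :: "'a::field poly"
  assumes "\<And>t. t < r \<Longrightarrow> coeff ([:1, 1:] ^ u * q) t = 0" "t < r"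
  shows "coeff q t = 0"
  using assms
proof (induction u arbitrary: q t)
  case (Suc u)
  have "coeff ([:1, 1:] ^ u * ([:1, 1:] * q)) i = 0" if "i < r" for i
    using Suc.prems(1)[OF that] by (simp only: power_Suc2 mult.assoc)
  then have "coeff ([:1, 1:] * q) i = 0" if "i < r" for i
    using Suc.IH that by blast
  then have step: "coeff q i = - (case i of 0 \<Rightarrow> 0 | Suc i' \<Rightarrow> coeff q i')" if "i < r" for i
    using that by (simp add: coeff_pCons eq_neg_iff_add_eq_0)
  from Suc.prems(2) show ?case
  proof (induction t)
    case 0
    then show ?case using step[of 0] by simp
  next
    case (Suc t)
    then show ?case using step[of "Suc t"] by simp
  qed
qed simp

lemma triangular_combination:
  fixes c :: "nat \<Rightarrow> 'a::field poly"
  assumes c: "\<And>a. a < r \<Longrightarrow> c a \<noteq> 0 \<and> degree (c a) = a" and k: "b0 < r" "k b0 \<noteq> 0"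
  obtains b where "b < r" "k b \<noteq> 0" "degree (\<Sum>a<r. Polynomial.smult (k a) (c a)) = b"
    "(\<Sum>a<r. Polynomial.smult (k a) (c a)) \<noteq> 0"
proof -
  let ?S = "\<Sum>a<r. Polynomial.smult (k a) (c a)"
  define b where "b = Max {a. a < r \<and> k a \<noteq> 0}"
  have "b \<in> {a. a < r \<and> k a \<noteq> 0}" unfolding b_def by (rule Max_in) (use k in auto)
  then have b: "b < r" "k b \<noteq> 0" by auto
  have above: "k a = 0" if "b < a" "a < r" for a
  proof (rule ccontr)
    assume "k a \<noteq> 0"
    then have "a \<le> b" unfolding b_def using that by (intro Max_ge) auto
    then show False using that by simp
  qed
  have high: "coeff (Polynomial.smult (k a) (c a)) i = 0" if "a < r" "b \<le> i" "a \<noteq> b \<or> b < i" for a i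
  proof (cases "b < a")
    case False
    then have "degree (c a) < i" using that c by auto
    then show ?thesis by (simp add: coeff_eq_0)
  qed (use above that in simp)
  have "coeff ?S b = (\<Sum>a\<in>{b}. coeff (Polynomial.smult (k a) (c a)) b)"
    unfolding coeff_sum by (rule sum.mono_neutral_right) (use b high in auto)
  also have "\<dots> \<noteq> 0" using b c[OF b(1)] leading_coeff_0_iff[of "c b"] by auto
  finally have nz: "coeff ?S b \<noteq> 0" .
  moreover have "degree ?S \<le> b"
    by (rule degree_le) (auto simp: coeff_sum simp del: coeff_smult intro!: sum.neutral high)
  ultimately have "degree ?S = b" using le_degree le_antisym by blast
  then show ?thesis using that b nz by auto
qed

text \<open>
A vanishing combination of the chain vectors vanishes in each degree \<open>m\<close> separately. There it is a
single form whose encoding combines polynomials of distinct degrees, so unless all its coefficients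
are zero its degree \<open>b\<close> is that of some generator occurring in degree \<open>m\<close>. But chains stop before degree \<open>M b\<close>, and by
minimality no form encoded by a polynomial of degree \<open>b\<close> is annihilated before.
\<close>

lemma form_vec_independent:
  fixes c :: "nat \<Rightarrow> 'a::field poly" and F :: "'a itself"
  assumes rs: "r \<le> s" and c: "\<And>a. a < r \<Longrightarrow> c a \<noteq> 0 \<and> degree (c a) = a"
    and zero: "\<And>i. i < r * s \<Longrightarrow>
      (\<Sum>a<r. \<Sum>j<jordan_length F r s a. w a j * form_vec r s (a + j) (c a) $ i) = 0"
    and a0: "a0 < r" "j0 < jordan_length F r s a0"
  shows "w a0 j0 = 0"
proof -
  let ?l = "jordan_length F r s"
  \<comment> \<open>\<open>C m\<close> encodes the part of degree \<open>m\<close>, and \<open>k m a\<close> is the share of the generator \<open>a\<close> in it.\<close>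
  define k where "k = (\<lambda>m a. if a \<le> m \<and> m - a < ?l a then w a (m - a) else 0)"
  define C where "C = (\<lambda>m. \<Sum>a<r. Polynomial.smult (k m a) (c a))"
  have "annihilated r s m (C m)" for m
    unfolding annihilated_def
  proof (intro allI impI)
    fix u assume u: "u < s" "m < r + u"
    show "form_coeff m (C m) u = 0"
    proof (cases "u \<le> m")
      case True
      \<comment> \<open>The part of the combination at \<open>y^u\<close>, with the unit \<open>(1 + x)^u\<close> removed.\<close>
      define q where "q = (\<Sum>a<r. \<Sum>j<?l a. monom (w a j * form_coeff (a + j) (c a) u) (a + j - u))"
      have "coeff ([:1, 1:] ^ u * q) t = 0" if t: "t < r" for t
      proof -
        define i where "i = (r - 1 - t) * s + (s - 1 - u)"
        have "i < (r - 1 - t) * s + s" using u by (simp add: i_def)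
        also have "\<dots> = Suc (r - 1 - t) * s" by simp
        also have "\<dots> \<le> r * s" by (rule mult_right_mono) (use t in auto)
        finally have i: "i < r * s" .
        have "(x * s + y) div s = x" "(x * s + y) mod s = y" if "y < s" for x y
          using that by simp_all
        moreover have "s - 1 - u < s" using u by simp
        ultimately have "i div s = r - 1 - t" "i mod s = s - 1 - u" unfolding i_def by blast+
        then have ut: "s - 1 - i mod s = u" "r - 1 - i div s = t" using u t by simp_all
        have "coeff ([:1, 1:] ^ u * q) t =
            coeff (\<Sum>a<r. \<Sum>j<?l a. Polynomial.smult (w a j) (form_row (a + j) (c a) u)) t"
          unfolding q_def sum_distrib_left
          by (intro arg_cong[where f = "\<lambda>p. coeff p t"] sum.cong refl)
             (simp add: form_row_def monom_altdef mult_ac)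
        also have "\<dots> = (\<Sum>a<r. \<Sum>j<?l a. w a j * form_vec r s (a + j) (c a) $ i)"
        proof -
          have "form_vec r s m' c' $ i = coeff (form_row m' c' u) t" for m' and c' :: "'a poly"
            unfolding form_vec_def tensor_vec_def using i by (simp only: index_vec ut)
          then show ?thesis by (simp add: coeff_sum)
        qed
        also have "\<dots> = 0" by (rule zero[OF i])
        finally show ?thesis .
      qed
      then have "coeff q (m - u) = 0"
        using coeff_0_of_one_plus_X_power[of r u q "m - u"] u True by auto
      moreover have "coeff q (m - u) = (\<Sum>a<r. k m a * form_coeff m (c a) u)"
        unfolding q_def coeff_sum
      proof (rule sum.cong)
        fix a assume "a \<in> {..<r}"
        have "(\<Sum>j<?l a. coeff (monom (w a j * form_coeff (a + j) (c a) u) (a + j - u)) (m - u)) =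
            (\<Sum>j<?l a. if j = m - a \<and> a \<le> m then w a j * form_coeff (a + j) (c a) u else 0)"
        proof (rule sum.cong)
          fix j
          have "form_coeff (a + j) (c a) u = 0" if "a + j < u" using that by (rule form_coeff_eq_0)
          then show "coeff (monom (w a j * form_coeff (a + j) (c a) u) (a + j - u)) (m - u) =
              (if j = m - a \<and> a \<le> m then w a j * form_coeff (a + j) (c a) u else 0)"
            using True by (cases "a + j < u") auto
        qed simp
        also have "\<dots> = k m a * form_coeff m (c a) u"
          by (cases "a \<le> m") (auto simp: k_def)
        finally show "(\<Sum>j<?l a. coeff (monom (w a j * form_coeff (a + j) (c a) u) (a + j - u)) (m - u)) =
            k m a * form_coeff m (c a) u" .
      qed simp
      ultimately show ?thesis by (simp add: C_def form_coeff_sum form_coeff_smult)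
    qed (simp add: form_coeff_eq_0)
  qed
  note ann = this
  show ?thesis
  proof (rule ccontr)
    let ?m = "a0 + j0"
    assume "w a0 j0 \<noteq> 0"
    then have knz: "k ?m a0 \<noteq> 0" using a0 by (simp add: k_def)
    obtain b where b: "b < r" "k ?m b \<noteq> 0" "degree (C ?m) = b" "C ?m \<noteq> 0"
      unfolding C_def by (rule triangular_combination[where k = "k ?m", OF c a0(1) knz])
    then have "b \<le> ?m" "?m < annihilation_degree F r s b"
      by (auto simp: k_def jordan_length_def split: if_splits)
    then show False using not_annihilated_below[OF rs, of "C ?m" ?m F] b ann by auto
  qed
qed

text \<open>
The chain of the generator \<open>c a\<close> consists of its multiples in the degrees from \<open>a\<close> up to
\<open>annihilation_degree F r s a - 1\<close>. The nilpotent part of a Jordan block sends each basis vector to the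
preceding one, so the chain is listed from the highest degree downwards.
\<close>

lemma jordan_partition_eq:
  fixes F :: "'a::field itself"
  assumes rs: "r \<le> s"
  shows "jordan_partition F r s = map (jordan_length F r s) [0..<r]"
proof -
  let ?l = "jordan_length F r s"
  let ?K = "kronecker_product (jordan_block r (1::'a)) (jordan_block s 1)"
  have "\<exists>c :: 'a poly. c \<noteq> 0 \<and> degree c = a \<and> annihilated r s (a + ?l a) c" if "a < r" for a
    using annihilation_degree_witness[OF rs that, of F] unfolding jordan_length_def
    by (metis le_add_diff_inverse)
  then obtain c :: "nat \<Rightarrow> 'a poly" where
    c: "\<And>a. a < r \<Longrightarrow> c a \<noteq> 0 \<and> degree (c a) = a \<and> annihilated r s (a + ?l a) (c a)"
    by metis
  define v where "v = (\<lambda>a j. form_vec r s (a + (?l a - 1 - j)) (c a))"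
  have "similar_mat ?K (jordan_matrix (map (\<lambda>a. (?l a, 1)) [0..<r]))"
  proof (rule similar_mat_jordan_matrix_of_chains[where v = v and n = "r * s"])
    show "?K \<in> carrier_mat (r * s) (r * s)" by (simp add: kronecker_product_def)
    show "sum_list (map ?l [0..<r]) = r * s"
      using sum_jordan_length[OF rs, of F] by (simp add: interv_sum_list_conv_sum_set_nat lessThan_atLeast0)
  next
    fix a j assume "a \<in> set [0..<r]" "j < ?l a"
    then have a: "a < r" "j < ?l a" by auto
    show "v a j \<in> carrier_vec (r * s)" by (simp add: v_def form_vec_def tensor_vec_def)
    have "?K *\<^sub>v v a j = v a j + form_vec r s (Suc (a + (?l a - 1 - j))) (c a)"
      unfolding v_def by (rule kronecker_mult_form_vec) (use c[OF a(1)] in auto)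
    moreover have "form_vec r s (Suc (a + (?l a - 1 - j))) (c a) = (if j = 0 then 0\<^sub>v (r * s) else v a (j - 1))"
    proof (cases j)
      case 0
      then have "Suc (a + (?l a - 1 - j)) = a + ?l a" using a by simp
      then show ?thesis using form_vec_eq_0 c[OF a(1)] 0 by metis
    next
      case (Suc i)
      then have e: "Suc (a + (?l a - 1 - j)) = a + (?l a - 1 - (j - 1))" using a by simp
      show ?thesis using Suc unfolding v_def e by simp
    qed
    ultimately show "?K *\<^sub>v v a j = 1 \<cdot>\<^sub>v v a j + (if j = 0 then 0\<^sub>v (r * s) else v a (j - 1))" by simp
  next
    fix W a j
    assume *: "\<And>i. i < r * s \<Longrightarrow> (\<Sum>a\<in>set [0..<r]. \<Sum>j<?l a. W a j * v a j $ i) = 0"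
      "a \<in> set [0..<r]" "j < ?l a"
    define w where "w = (\<lambda>a j. W a (?l a - 1 - j))"
    have zero: "(\<Sum>a<r. \<Sum>j<?l a. w a j * form_vec r s (a + j) (c a) $ i) = 0" if "i < r * s" for i
    proof -
      have "(\<Sum>j<?l a. w a j * form_vec r s (a + j) (c a) $ i) = (\<Sum>j<?l a. W a j * v a j $ i)" for a
        by (subst sum.nat_diff_reindex[symmetric]) (auto simp: w_def v_def intro!: sum.cong)
      then show ?thesis using *(1)[OF that] by (simp add: lessThan_atLeast0)
    qed
    have "w a (?l a - 1 - j) = 0"
      by (rule form_vec_independent[OF rs _ zero]) (use c * in auto)
    then show "W a j = 0" using *(3) by (simp add: w_def)
  qed simp
  moreover have "0 \<notin> set (map ?l [0..<r])" using jordan_length_pos[OF rs, of _ F] by fastforce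
  moreover have "sorted_wrt (\<ge>) (map ?l [0..<r])"
  proof -
    have "?l b \<le> ?l a" if "a \<le> b" "b < r" for a b
      using that
    proof (induction b rule: dec_induct)
      case (step b)
      then show ?case using jordan_length_Suc_le[OF rs, of b F] by simp
    qed simp
    then show ?thesis by (auto simp: sorted_wrt_iff_nth_less)
  qed
  ultimately have "is_jordan_partition F r s (map ?l [0..<r])"
    unfolding is_jordan_partition_def jordan_nf_def by (auto simp: comp_def)
  then show ?thesis
    unfolding jordan_partition_def
    using is_jordan_partition_ex1[where 'a = 'a, of r s] 
    by (intro the1_equality) (simp_all add: is_jordan_partition_def)
qed

section \<open>Reversal of the composition\<close>

text \<open>
Sequences that are constant on the same stretches differ by an injective renaming of their values;
if one decreases and the other increases, the renaming reverses the order.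
\<close>

lemma composition_eq_of_same_pattern:
  fixes f g :: "nat \<Rightarrow> nat"
  assumes f: "\<And>i. Suc i < n \<Longrightarrow> f (Suc i) \<le> f i" and g: "\<And>i. Suc i < n \<Longrightarrow> g i \<le> g (Suc i)"
    and pat: "\<And>i. Suc i < n \<Longrightarrow> f (Suc i) = f i \<longleftrightarrow> g (Suc i) = g i"
  shows "map (count_list (map f [0..<n])) (rev (sorted_list_of_set (f ` {0..<n}))) =
    map (count_list (map g [0..<n])) (sorted_list_of_set (g ` {0..<n}))"
proof -
  have ord: "f j \<le> f i \<and> g i \<le> g j \<and> (f j = f i \<longleftrightarrow> g j = g i)" if "i \<le> j" "j < n" for i j
    using that
  proof (induction j rule: dec_induct)
    case (step j)
    then have IH: "f j \<le> f i" "g i \<le> g j" "f j = f i \<longleftrightarrow> g j = g i" and j: "Suc j < n" by auto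
    show ?case
    proof (cases "f (Suc j) = f j")
      case True
      then show ?thesis using IH pat[OF j] by simp
    next
      case False
      then have "f (Suc j) < f i" "g i < g (Suc j)" using IH f[OF j] g[OF j] pat[OF j] by linarith+
      then show ?thesis by simp
    qed
  qed simp
  \<comment> \<open>The renaming of values; by \<open>ord\<close> the choice of the position \<open>i\<close> does not matter.\<close>
  define h where "h = (\<lambda>x. g (SOME i. i < n \<and> f i = x))"
  have same: "g i = g j" if "f i = f j" "i < n" "j < n" for i j
    using ord that by (metis nat_le_linear)
  have h: "h (f i) = g i" if "i < n" for i
  proof -
    have "(SOME i'. i' < n \<and> f i' = f i) < n \<and> f (SOME i'. i' < n \<and> f i' = f i) = f i"
      by (rule someI[where P = "\<lambda>i'. i' < n \<and> f i' = f i"]) (use that in simp)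
    then show ?thesis unfolding h_def using same that by blast
  qed
  have anti: "h y < h x" if xy: "x \<in> f ` {0..<n}" "y \<in> f ` {0..<n}" "x < y" for x y
  proof -
    obtain i j where ij: "x = f i" "y = f j" "i < n" "j < n"
      using xy(1,2) by auto
    have lt: "f i < f j" using xy(3) ij by simp
    then have le: "j \<le> i" using ord[of i j] ij(4) by (meson leD nat_le_linear)
    have "g j \<le> g i" "g i = g j \<Longrightarrow> f i = f j" using ord[OF le ij(3)] by blast+
    then have "g j < g i" using lt by linarith
    then show ?thesis using ij h by simp
  qed
  have inj: "inj_on h (f ` {0..<n})"
    by (rule linorder_inj_onI) (use anti in \<open>force+\<close>)
  have gh: "map g [0..<n] = map h (map f [0..<n])" using h by simp
  have count: "count_list (map g [0..<n]) (h x) = count_list (map f [0..<n]) x" if "x \<in> f ` {0..<n}" for x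
    unfolding gh by (rule count_list_inj_map) (use inj that in auto)
  let ?L = "sorted_list_of_set (f ` {0..<n})"
  have "sorted_wrt (<) (map h (rev ?L))"
  proof -
    have "sorted_wrt (<) ?L" by simp
    then have "sorted_wrt (\<lambda>x y. h y < h x) ?L"
      by (rule sorted_wrt_mono_rel[rotated]) (use anti in simp)
    then show ?thesis by (simp add: sorted_wrt_map sorted_wrt_rev)
  qed
  moreover have "set (map h (rev ?L)) = g ` {0..<n}" using h by (force simp: image_image)
  ultimately have "sorted_list_of_set (g ` {0..<n}) = map h (rev ?L)"
    by (intro strict_sorted_equal) simp_all
  then show ?thesis using count by simp
qed

text \<open>
A drop at \<open>k\<close> for \<open>s\<close> corresponds to a drop at \<open>r - k\<close> for \<open>s'\<close>, so the lengths for \<open>s\<close> and the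
reversed lengths for \<open>s'\<close> are constant on the same stretches.
\<close>

lemma jordan_composition_reverse:
  fixes F :: "'a::field itself"
  assumes p: "prime p" "CHAR('a) = p" and s: "r \<le> s" "r \<le> s'"
    and small: "r + s \<le> p ^ Suc m" "r + s' \<le> p ^ Suc m" and dvd: "p ^ m dvd s + s'"
  shows "jordan_composition F r s = rev (jordan_composition F r s')"
proof -
  define f g where "f = jordan_length F r s" and "g = (\<lambda>i. jordan_length F r s' (r - 1 - i))"
  have rev: "map g [0..<r] = rev (map (jordan_length F r s') [0..<r])"
    by (rule nth_equalityI) (simp_all add: g_def rev_nth)
  have img: "g ` {0..<r} = set (map (jordan_length F r s') [0..<r])"
    using arg_cong[OF rev, of set] by simp
  have "map (count_list (map f [0..<r])) (rev (sorted_list_of_set (f ` {0..<r}))) =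
      map (count_list (map g [0..<r])) (sorted_list_of_set (g ` {0..<r}))"
  proof (rule composition_eq_of_same_pattern)
    fix i assume i: "Suc i < r"
    define k where "k = Suc i"
    have k: "0 < k" "k < r" "0 < r - k" "r - k < r" "r - (r - k) = k" using i by (auto simp: k_def)
    have idx: "r - 1 - i = r - k" "r - 1 - Suc i = r - k - 1" by (auto simp: k_def)
    have "Suc (r - k - 1) = r - k" using k by simp
    then show le_f: "f (Suc i) \<le> f i" and le_g: "g i \<le> g (Suc i)"
      using jordan_length_Suc_le[OF s(1), of i F] jordan_length_Suc_le[OF s(2), of "r - k - 1" F] i k
      unfolding f_def g_def idx by simp_all
    have "f (Suc i) < f i \<longleftrightarrow> \<not> int p dvd box_det (s - k) (r - k) k"
      using jordan_length_drop_iff[OF s(1) k(1,2), of F] p(2)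
      by (simp add: f_def k_def of_int_eq_0_iff_char_dvd)
    also have "\<dots> \<longleftrightarrow> \<not> int p dvd box_det (s' - (r - k)) k (r - k)"
    proof -
      have "s - k + (s' - (r - k)) + k + (r - k) = s + s'" using s k by simp
      then have "p ^ m dvd s - k + (s' - (r - k)) + k + (r - k)" using dvd by simp
      then show ?thesis
        by (subst dvd_box_det_symmetric[OF p(1), where m = m and a' = "s' - (r - k)"]) (use small s k in auto)
    qed
    also have "\<dots> \<longleftrightarrow> g i < g (Suc i)"
      using jordan_length_drop_iff[OF s(2) k(3,4), of F] p(2)
      unfolding g_def idx k(5) by (simp only: of_int_eq_0_iff_char_dvd)
    finally show "f (Suc i) = f i \<longleftrightarrow> g (Suc i) = g i" using le_f le_g by linarith
  qed
  then have "jordan_composition F r s =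
      map (count_list (rev (map (jordan_length F r s') [0..<r])))
        (sorted_list_of_set (set (map (jordan_length F r s') [0..<r])))"
    unfolding jordan_composition_def jordan_partition_eq[OF s(1)] Let_def rev img f_def by simp
  also have "\<dots> = rev (jordan_composition F r s')"
  proof -
    have "count_list (rev xs) = count_list xs" for xs :: "nat list" by (rule ext) simp
    then show ?thesis
      unfolding jordan_composition_def jordan_partition_eq[OF s(2)] Let_def rev_map[symmetric] by simp
  qed
  finally show ?thesis .
qed

theorem theorem4:
  fixes p r n :: nat and b d s :: int
  assumes "prime p"
    and "CHAR('a::field) = p"
    and "r > 0" and "n > 0"
    and "p ^ (n - 1) < r"
    and "real r \<le> (real p - 1) / 2 * real p ^ (n - 1)"
    and "s = b * int p ^ (n - 1) + d"
    and "int r \<le> s"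
    and "s \<le> (int p - \<lceil>real r / real p ^ (n - 1)\<rceil>) * int p ^ (n - 1)"
    and "int r \<le> b * int p ^ (n - 1) + (int p ^ (n - 1) - d)"
    and "b * int p ^ (n - 1) + (int p ^ (n - 1) - d)
           \<le> (int p - \<lceil>real r / real p ^ (n - 1)\<rceil>) * int p ^ (n - 1)"
  shows "jordan_composition TYPE('a) r (nat s)
       = rev (jordan_composition TYPE('a) r (nat (b * int p ^ (n - 1) + (int p ^ (n - 1) - d))))"
proof -
  define q where "q = p ^ (n - 1)"
  define t where "t = b * int p ^ (n - 1) + (int p ^ (n - 1) - d)"
  have q: "0 < q" using assms(1) by (simp add: q_def prime_gt_0_nat)
  have pq: "p ^ Suc (n - 1) = p * q" by (simp add: q_def)
  have "real r / real q \<le> of_int \<lceil>real r / real q\<rceil>" by (rule le_of_int_ceiling)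
  then have "real r / real q * real q \<le> of_int \<lceil>real r / real q\<rceil> * real q"
    by (rule mult_right_mono) simp
  then have "real r \<le> of_int \<lceil>real r / real q\<rceil> * real q" using q by simp
  then have "real_of_int (int r) \<le> real_of_int (\<lceil>real r / real q\<rceil> * int q)" by simp
  \<comment> \<open>Since \<open>r\<close> is at most \<open>q\<close> times the ceiling of \<open>r / q\<close>, the upper bounds give \<open>r + s \<le> p q\<close>.\<close>
  then have ceil: "int r \<le> \<lceil>real r / real q\<rceil> * int q" by (simp only: of_int_le_iff)
  have bound: "r + nat x \<le> p ^ Suc (n - 1)"
    if "int r \<le> x" "x \<le> (int p - \<lceil>real r / real p ^ (n - 1)\<rceil>) * int p ^ (n - 1)" for x
  proof -
    have "x \<le> (int p - \<lceil>real r / real q\<rceil>) * int q" using that(2) by (simp add: q_def)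
    then have "int r + x \<le> int (p * q)" using ceil by (simp add: algebra_simps)
    then have "int (r + nat x) \<le> int (p * q)" using that(1) by simp
    then show ?thesis unfolding pq by (simp only: of_nat_le_iff)
  qed
  have "int (nat s + nat t) = int q * (2 * b + 1)"
    using assms(7,8,10) by (simp add: t_def q_def algebra_simps)
  then have "int q dvd int (nat s + nat t)" by simp
  then have "p ^ (n - 1) dvd nat s + nat t" unfolding q_def by (simp only: of_nat_dvd_iff)
  moreover have "r \<le> nat s" "r \<le> nat t" using assms(8,10) unfolding t_def[symmetric] by linarith+
  moreover have "r + nat s \<le> p ^ Suc (n - 1)" "r + nat t \<le> p ^ Suc (n - 1)"
    using bound assms(8-11) unfolding t_def[symmetric] by blast+
  ultimately show ?thesis
    unfolding t_def[symmetric] by (intro jordan_composition_reverse[OF assms(1,2)])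
qed

end
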